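(* Let $\Gamma\subset SL(2,\mathbb Z)$ be a congruence subgroup, $n,k\in\mathbb Z$, $f\in\mathcal M_{2n}(\Gamma)$ and $h\in\mathcal M_{2k}(\Gamma)$. Then for every integer $s\ge0$ the generalized Rankin-Cohen bracket $$[f,h]^{\sim}_s:=\sum_{\substack{m+l=s\\ m,l\ge0}}(-1)^m\,c_{2n,m}\,c_{2k,l}\,f^{[m]}\,h^{[l]}$$ (the coefficient of $X^s$ in $\tilde f(\tau,-X)\,\tilde h(\tau,X)$) belongs to $\mathcal M_{2n+2k+2s}(\Gamma)$.
   Context: $\mathbb H$ is the upper half plane. $\mathcal M_j(\Gamma)$ is the space of meromorphic modular forms of weight $j$ for $\Gamma$ that are holomorphic on $\mathbb H$ (and meromorphic at the cusps). $E_2(\tau)=1-24\sum_{r\ge1}\sigma_1(r)e^{2\pi ir\tau}$ is the Eisenstein series of weight 2, and $f^{(m)}$ denotes the $m$-th derivative. For $n\le 0$, $f\in\mathcal M_{2n}(\Gamma)$, put $N=-n\ge0$ and for $m\ge0$ $$\eta^f_m(\tau)=\frac{\pi i}{6\,m!}\sum_{j=0}^{2N}\frac{1}{j!\,(2N-j+m+1)!}f^{(j)}(\tau)E_2^{(2N+m-j)}(\tau).$$ For $f\in\mathcal M_{2n}(\Gamma)$, $n\in\mathbb Z$, $m\ge0$ define $f^{[m]}=f^{(m)}$ if $n>0$, or if $n\le0$ and $0\le m\le-2n$; and $f^{[m]}=\eta^f_{m+2n-1}$ if $n\le 0$ and $m\ge-2n+1$. Define constants $c_{2n,m}$ by: $c_{2n,m}=\frac{(2n-1)!}{m!\,(m+2n-1)!}$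 if $n>0$; $c_{2n,m}=\frac{(-1)^m(-2n-m)!}{m!}$ if $n\le0$ and $0\le m\le-2n$; $c_{2n,m}=1$ if $n\le0$ and $m\ge-2n+1$. Finally $\tilde f(\tau,X)=\sum_{m\ge0}c_{2n,m}f^{[m]}(\tau)X^m$, and $\tilde h$ is defined likewise from $h\in\mathcal M_{2k}(\Gamma)$. *)

theory Defs
  imports
    "HOL-Complex_Analysis.Complex_Analysis"
    "HOL-Algebra.Group"
    "HOL-Number_Theory.Cong"
begin

definition upper_half_plane :: "complex set" where
  "upper_half_plane = {\<tau>. Im \<tau> > 0}"

definition SL2Z :: "(int^2^2) monoid" where
  "SL2Z = \<lparr>carrier = {A. det A = 1}, mult = (**), one = mat 1\<rparr>"

lemma group_SL2Z: "group SL2Z"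
proof (rule groupI)
  fix A :: "int^2^2" assume "A \<in> carrier SL2Z"
  then have d: "A$1$1 * A$2$2 - A$1$2 * A$2$1 = 1"
    by (simp add: SL2Z_def det_2)
  define B :: "int^2^2" where
    "B = (\<chi> i j. if i = 1 then (if j = 1 then A$2$2 else - A$1$2)
                         else (if j = 1 then - A$2$1 else A$1$1))"
  have "det B = 1"
    using d by (simp add: B_def det_2 algebra_simps)
  moreover have "B ** A = mat 1"
    using d by (simp add: B_def vec_eq_iff forall_2 matrix_matrix_mult_def sum_2 mat_def algebra_simps)
  ultimately show "\<exists>B\<in>carrier SL2Z. B \<otimes>\<^bsub>SL2Z\<^esub> A = \<one>\<^bsub>SL2Z\<^esub>"
    by (auto simp: SL2Z_def)
qed (auto simp: SL2Z_def det_mul matrix_mul_assoc)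

definition principal_congruence_subgroup :: "nat \<Rightarrow> (int^2^2) set" where
  "principal_congruence_subgroup N =
     {A \<in> carrier SL2Z. \<forall>i j. [A$i$j = (mat 1 :: int^2^2)$i$j] (mod int N)}"

definition congruence_subgroup :: "(int^2^2) set \<Rightarrow> bool" where
  "congruence_subgroup \<Gamma> \<longleftrightarrow>
     subgroup \<Gamma> SL2Z \<and> (\<exists>N\<ge>1. principal_congruence_subgroup N \<subseteq> \<Gamma>)"

definition automorphy_factor :: "int^2^2 \<Rightarrow> complex \<Rightarrow> complex" where
  "automorphy_factor A \<tau> = of_int (A$2$1) * \<tau> + of_int (A$2$2)"

definition moebius :: "int^2^2 \<Rightarrow> complex \<Rightarrow> complex" where
  "moebius A \<tau> = (of_int (A$1$1) * \<tau> + of_int (A$1$2)) / automorphy_factor A \<tau>"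

definition slash :: "int \<Rightarrow> (complex \<Rightarrow> complex) \<Rightarrow> int^2^2 \<Rightarrow> complex \<Rightarrow> complex" where
  "slash j f A \<tau> = automorphy_factor A \<tau> powi (- j) * f (moebius A \<tau>)"

text \<open>
  A function on the upper half plane is meromorphic at \<open>\<infinity>\<close> if it is a function of
  \<open>q = exp (2\<pi>i\<tau>/w)\<close>, for some positive integer \<open>w\<close>, that extends meromorphically to \<open>q = 0\<close>,
  i.e. if its \<open>q\<close>-expansion has only finitely many negative exponents.
\<close>

definition meromorphic_at_infinity :: "(complex \<Rightarrow> complex) \<Rightarrow> bool" where
  "meromorphic_at_infinity f \<longleftrightarrow>
     (\<exists>(w::nat) g. w \<ge> 1 \<and> g meromorphic_on {0} \<and>
        (\<forall>\<tau>\<in>upper_half_plane. f \<tau> = g (exp (2 * of_real pi * \<i> * \<tau> / of_nat w))))"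

text \<open>
  Functions on the upper half plane are total functions on \<open>complex\<close>; membership in the
  following set only constrains their values on the upper half plane.
  Meromorphy at the cusp \<open>\<alpha>(\<infinity>)\<close> is meromorphy of \<open>slash j f \<alpha>\<close> at \<open>\<infinity>\<close>.
\<close>

definition modular_forms :: "int \<Rightarrow> (int^2^2) set \<Rightarrow> (complex \<Rightarrow> complex) set" where
  "modular_forms j \<Gamma> =
     {f. f holomorphic_on upper_half_plane \<and>
         (\<forall>\<gamma>\<in>\<Gamma>. \<forall>\<tau>\<in>upper_half_plane. f (moebius \<gamma> \<tau>) = automorphy_factor \<gamma> \<tau> powi j * f \<tau>) \<and>
         (\<forall>\<alpha>\<in>carrier SL2Z. meromorphic_at_infinity (slash j f \<alpha>))}"

definition sigma1 :: "nat \<Rightarrow> nat" where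
  "sigma1 r = (\<Sum>d | d dvd r. d)"

definition E2 :: "complex \<Rightarrow> complex" where
  "E2 \<tau> = 1 - 24 * (\<Sum>r. of_nat (sigma1 (Suc r)) * exp (2 * of_real pi * \<i> * of_nat (Suc r) * \<tau>))"

text \<open>\<open>eta n\<close> and hence \<open>bracket_deriv n\<close> only depend on the half-weight \<open>n\<close> of the form \<open>f\<close>
  and are meant for \<open>f \<in> modular_forms (2 * n) \<Gamma>\<close>; \<open>eta n\<close> is only used for \<open>n \<le> 0\<close>.\<close>

definition eta :: "int \<Rightarrow> (complex \<Rightarrow> complex) \<Rightarrow> nat \<Rightarrow> complex \<Rightarrow> complex" where
  "eta n f m \<tau> =
     (let N = nat (- n) in
      of_real pi * \<i> / (6 * fact m) *
        (\<Sum>j = 0..2*N. 1 / (fact j * fact (2*N - j + m + 1)) *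
           (deriv ^^ j) f \<tau> * (deriv ^^ (2*N + m - j)) E2 \<tau>))"

definition bracket_deriv :: "int \<Rightarrow> (complex \<Rightarrow> complex) \<Rightarrow> nat \<Rightarrow> complex \<Rightarrow> complex" where
  "bracket_deriv n f m =
     (if n > 0 \<or> int m \<le> - 2 * n then (deriv ^^ m) f
      else eta n f (nat (int m + 2 * n - 1)))"

definition lift_coeff :: "int \<Rightarrow> nat \<Rightarrow> complex" where
  "lift_coeff n m =
     (if n > 0 then fact (nat (2 * n - 1)) / (fact m * fact (nat (int m + 2 * n - 1)))
      else if int m \<le> - 2 * n then (-1) ^ m * fact (nat (- 2 * n - int m)) / fact m
      else 1)"

definition rankin_cohen_bracket ::
  "int \<Rightarrow> int \<Rightarrow> nat \<Rightarrow> (complex \<Rightarrow> complex) \<Rightarrow> (complex \<Rightarrow> complex) \<Rightarrow> complex \<Rightarrow> complex" where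
  "rankin_cohen_bracket n k s f h \<tau> =
     (\<Sum>(m, l) \<in> {(m, l). m + l = s}.
        (-1) ^ m * lift_coeff n m * lift_coeff k l * bracket_deriv n f m \<tau> * bracket_deriv k h l \<tau>)"

definition lift_series :: "int \<Rightarrow> (complex \<Rightarrow> complex) \<Rightarrow> complex \<Rightarrow> complex fps" where
  "lift_series n f \<tau> = Abs_fps (\<lambda>m. lift_coeff n m * bracket_deriv n f m \<tau>)"

lemma rankin_cohen_bracket_eq_coeff:
  "rankin_cohen_bracket n k s f h \<tau> =
     fps_nth (fps_compose (lift_series n f \<tau>) (- fps_X) * lift_series k h \<tau>) s"
proof -
  have "{(m, l). m + l = s} = (\<lambda>m. (m, s - m)) ` {0..s}"
    by (auto simp: image_iff)
  moreover have "inj_on (\<lambda>m. (m, s - m)) {0..s}"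
    by (auto simp: inj_on_def)
  ultimately show ?thesis
    unfolding rankin_cohen_bracket_def lift_series_def fps_compose_uminus' fps_mult_nth
    by (simp add: sum.reindex) (simp add: mult_ac)
qed

end

theory Submission
  imports Defs
begin

unbundle no fps_syntax

text \<open>
  For \<open>\<alpha> = (a b; c d)\<close> write \<open>J = c \<tau> + d\<close> and \<open>K = c / J\<close>. The whole argument rests on one
  equation, the Kuznetsov-Cohen functional equation
  \<open>lift(f)(\<alpha> \<tau>, X / J\<^sup>2) = J^(2n) exp(K X) lift(f|\<alpha>)(\<tau>, X)\<close>
  for the formal series \<^const>\<open>lift_series\<close> (lemma \<open>lift_series_moebius\<close>). Given this, in the product
  \<open>lift(f)(\<tau>, -X) lift(h)(\<tau>, X)\<close> the factors \<open>exp(-K X)\<close> and \<open>exp(K X)\<close> cancel, so every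
  coefficient of the product commutes with slashing: \<open>[f, h]|\<alpha> = [f|\<alpha>, h|\<alpha>]\<close> for all
  \<open>\<alpha> \<in> SL(2, Z)\<close> (lemma \<open>rankin_cohen_bracket_moebius\<close>). For \<open>\<alpha> \<in> \<Gamma>\<close> this is modularity. For
  arbitrary \<open>\<alpha>\<close> it reduces meromorphy of \<open>[f, h]\<close> at the cusp \<open>\<alpha>(\<infinity>)\<close> to meromorphy of
  \<open>[f|\<alpha>, h|\<alpha>]\<close> at \<open>\<infinity>\<close>, which holds because the holomorphic functions on the upper half plane that are
  meromorphic at \<open>\<infinity>\<close> are closed under sums, products and differentiation and include \<open>E\<^sub>2\<close>. This is why the functional equation is
  stated for a pair of functions \<open>f\<close>, \<open>g\<close> with \<open>f|\<alpha> = g\<close> and not for invariant functions only.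

  In terms of the coefficients \<open>\<phi>\<^sub>m\<close> of the lift of \<open>f\<close> and \<open>\<psi>\<^sub>m\<close> of the lift of \<open>f|\<alpha>\<close> the equation reads
  \<open>\<phi>\<^sub>m(\<alpha> \<tau>) = J^(2n+2m) \<Sum>\<^sub>i K^i / i! \<psi>\<^bsub>m-i\<^esub>(\<tau>)\<close>. As long as \<open>\<phi>\<^sub>m\<close> is a multiple of \<open>f^(m)\<close>, the
  coefficients are normalised so that \<open>\<phi>\<^sub>m' = (m + 1)(m + 2n) \<phi>\<^bsub>m+1\<^esub>\<close>, and
  differentiating the equation for \<open>m\<close> gives the one for \<open>m + 1\<close>, unless \<open>m + 2n = 0\<close>
  (lemma \<open>exp_twist_transformation_step\<close>). For \<open>n \<le> 0\<close> this stops at \<open>m = -2n\<close>. The later coefficients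
  are bilinear in the earlier ones and in the coefficients of a similar weight-0 series
  \<open>1 + \<Sum>\<^sub>m (\<pi> i / 6) E\<^sub>2^(m) / (m! (m + 1)!) X^(m+1)\<close>. Infinitesimally, the functional equation is the
  rule \<open>d/dK \<phi>\<^sub>m = \<phi>\<^bsub>m-1\<^esub>\<close>, and Pascal's rule shows that this rule for both sequences implies it for the
  bilinear combinations (lemma \<open>tail_form_exp_twist\<close>).

  The analytic input is the transformation law of \<open>E\<^sub>2\<close>. Its inversion \<open>\<tau> \<mapsto> -1 / \<tau>\<close> is obtained from
  the conditionally convergent lattice sum \<open>\<Sum>\<^sub>c \<Sum>\<^sub>d 1 / (c \<tau> + d)\<^sup>2\<close>: interchanging the two summations
  costs \<open>-2 \<pi> i / \<tau>\<close>, which is computed with the partial fraction expansion of the cotangent. The Euclidean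
  algorithm extends the law from the inversion and the translations to all of \<open>SL(2, Z)\<close>.
\<close>

section \<open>Partial fractions and the Lipschitz formula\<close>

text \<open>
  Logarithmic derivative of Euler's reflection formula. The cotangent thereby inherits its partial
  fraction expansion from the defining series of the Digamma function, and one more derivative gives
  the expansion of \<open>1 / sin\<^sup>2\<close>.
\<close>

lemma Digamma_reflection_complex:
  fixes z :: complex
  assumes "z \<notin> \<int>"
  shows "Digamma (1 - z) - Digamma z = of_real pi * cot (of_real pi * z)"
proof -
  have "1 - z \<notin> \<int>"
    using assms by (metis Ints_1 Ints_diff diff_diff_eq2 add_diff_cancel_left')
  then have nonpos: "z \<notin> \<int>\<^sub>\<le>\<^sub>0" "1 - z \<notin> \<int>\<^sub>\<le>\<^sub>0"
    using assms nonpos_Ints_Int by blast+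
  have "((\<lambda>z. rGamma z * rGamma (1 - z)) has_field_derivative
          (- rGamma z * Digamma z) * rGamma (1 - z) + rGamma z * (rGamma (1 - z) * Digamma (1 - z))) (at z)"
    using nonpos by (auto intro!: derivative_eq_intros)
  moreover have "((\<lambda>z. sin (of_real pi * z) / of_real pi) has_field_derivative cos (of_real pi * z)) (at z)"
    by (auto intro!: derivative_eq_intros)
  ultimately have "(- rGamma z * Digamma z) * rGamma (1 - z) + rGamma z * (rGamma (1 - z) * Digamma (1 - z)) =
      cos (of_real pi * z)"
    unfolding rGamma_reflection_complex by (rule DERIV_unique)
  then have "rGamma z * rGamma (1 - z) * (Digamma (1 - z) - Digamma z) = cos (of_real pi * z)"
    by (simp add: algebra_simps)
  moreover have "sin (of_real pi * z) \<noteq> 0"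
    using assms by (auto simp: sin_eq_0)
  ultimately show ?thesis
    by (simp add: rGamma_reflection_complex cot_def field_simps)
qed

lemma Polygamma_1_reflection_complex:
  fixes z :: complex
  assumes "z \<notin> \<int>"
  shows "Polygamma 1 z + Polygamma 1 (1 - z) = (of_real pi / sin (of_real pi * z))\<^sup>2"
proof -
  have "1 - z \<notin> \<int>"
    using assms by (metis Ints_1 Ints_diff diff_diff_eq2 add_diff_cancel_left')
  then have nonpos: "z \<notin> \<int>\<^sub>\<le>\<^sub>0" "1 - z \<notin> \<int>\<^sub>\<le>\<^sub>0"
    using assms nonpos_Ints_Int by blast+
  have sin0: "sin (of_real pi * z) \<noteq> 0"
    using assms by (auto simp: sin_eq_0)
  have "((\<lambda>z. Digamma (1 - z) - Digamma z) has_field_derivative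
          - Polygamma 1 (1 - z) - Polygamma 1 z) (at z)"
    using nonpos by (auto intro!: derivative_eq_intros)
  moreover have "open (- \<int> :: complex set)"
    using closed_Ints by (rule open_Compl)
  ultimately have "((\<lambda>z. of_real pi * cot (of_real pi * z)) has_field_derivative
          - Polygamma 1 (1 - z) - Polygamma 1 z) (at z)"
    by (rule has_field_derivative_transform_within_open)
       (use assms Digamma_reflection_complex in auto)
  moreover have "((\<lambda>z. cot (of_real pi * z)) has_field_derivative
          - inverse ((sin (of_real pi * z))\<^sup>2) * of_real pi) (at z)"
    by (rule DERIV_chain2[OF DERIV_cot[OF sin0] DERIV_cmult_Id])
  then have "((\<lambda>z. of_real pi * cot (of_real pi * z)) has_field_derivative
          of_real pi * (- inverse ((sin (of_real pi * z))\<^sup>2) * of_real pi)) (at z)"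
    by (rule DERIV_cmult)
  ultimately have "- Polygamma 1 (1 - z) - Polygamma 1 z =
      of_real pi * (- inverse ((sin (of_real pi * z))\<^sup>2) * of_real pi)"
    by (rule DERIV_unique)
  then have "Polygamma 1 z + Polygamma 1 (1 - z) =
      of_real pi * (inverse ((sin (of_real pi * z))\<^sup>2) * of_real pi)"
    by (simp add: algebra_simps)
  then show ?thesis
    by (simp add: power2_eq_square divide_inverse mult_ac)
qed

lemma cot_partial_fractions_sums:
  fixes z :: complex
  assumes "z \<notin> \<int>"
  shows "(\<lambda>n. 1 / (of_nat (Suc n) - z) - 1 / (of_nat (Suc n) + z)) sums
           (1 / z - of_real pi * cot (of_real pi * z))"
proof -
  have nz: "z \<noteq> 0" "1 - z \<noteq> 0" "1 + z \<noteq> 0"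
    using assms by (auto simp: add_eq_0_iff)
  have D: "(\<lambda>k. inverse (of_nat (Suc k)) - inverse (w + of_nat k)) sums (Digamma w + euler_mascheroni)"
    if "w \<noteq> 0" for w :: complex
    using summable_sums[OF summable_Digamma[OF that]] by (simp add: Digamma_def)
  have "(\<lambda>k. (inverse (of_nat (Suc k)) - inverse (1 + z + of_nat k)) -
             (inverse (of_nat (Suc k)) - inverse (1 - z + of_nat k)))
        sums (Digamma (1 + z) + euler_mascheroni - (Digamma (1 - z) + euler_mascheroni))"
    by (intro sums_diff D nz)
  moreover have "Digamma (1 + z) = Digamma z + 1 / z"
    using Digamma_plus1[OF nz(1)] by (simp add: add.commute)
  ultimately show ?thesis
    using Digamma_reflection_complex[OF assms]
    by (simp add: algebra_simps divide_inverse)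
qed

lemma has_sum_int_split:
  fixes f :: "int \<Rightarrow> 'a :: topological_comm_monoid_add"
  assumes "((\<lambda>n. f (int n)) has_sum a) UNIV" "((\<lambda>n. f (- int (Suc n))) has_sum b) UNIV"
  shows "(f has_sum (a + b)) UNIV"
proof -
  have "(f has_sum a) (range int)"
    using assms(1) by (subst has_sum_reindex) (auto simp: o_def)
  moreover have "(f has_sum b) (range (\<lambda>n. - int (Suc n)))"
    using assms(2) by (subst has_sum_reindex) (auto simp: o_def inj_def)
  moreover have "range int \<inter> range (\<lambda>n. - int (Suc n)) = {}" by auto
  moreover have "range int \<union> range (\<lambda>n. - int (Suc n)) = UNIV"
  proof -
    have "x \<in> range int \<union> range (\<lambda>n. - int (Suc n))" for x :: int
      by (cases x) auto
    then show ?thesis by blast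
  qed
  ultimately show ?thesis
    using has_sum_Un_disjoint by metis
qed

lemma has_sum_nat_inverse_Suc_squares: "((\<lambda>n. 1 / (real n + 1)\<^sup>2) has_sum (pi\<^sup>2 / 6)) UNIV"
  by (rule norm_summable_imp_has_sum) (use inverse_squares_sums in \<open>auto simp: sums_iff add.commute\<close>)

lemma summable_on_int_inverse_squares: "(\<lambda>d::int. 1 / (real_of_int \<bar>d\<bar> + 1)\<^sup>2) summable_on UNIV"
proof -
  have "(\<lambda>n. 1 / (real n + 2)\<^sup>2) summable_on UNIV"
  proof (rule summable_on_comparison_test)
    show "(\<lambda>n. 1 / (real n + 1)\<^sup>2) summable_on UNIV"
      using has_sum_nat_inverse_Suc_squares by (rule has_sum_imp_summable)
    show "1 / (real n + 2)\<^sup>2 \<le> 1 / (real n + 1)\<^sup>2" for n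
      by (intro divide_left_mono power_mono mult_pos_pos) auto
  qed auto
  then obtain b where "((\<lambda>n. 1 / (real n + 2)\<^sup>2) has_sum b) UNIV"
    by (auto simp: summable_on_def)
  then show ?thesis
    using has_sum_int_split[of "\<lambda>d. 1 / (real_of_int \<bar>d\<bar> + 1)\<^sup>2", of "pi\<^sup>2 / 6" b] has_sum_nat_inverse_Suc_squares
    by (auto simp: add.commute dest!: has_sum_imp_summable)
qed

text \<open>
  These two bounds hold uniformly in \<open>C\<close>. Together they give \<open>C (\<bar>d\<bar> + 1) \<le> B \<bar>C \<tau> + d\<bar>\<^sup>2\<close>,
  which compares lattice sums with products of one-dimensional sums.
\<close>

lemma lattice_point_bounds:
  fixes C :: real and d :: int
  assumes "Im \<tau> > 0" "C \<ge> 1"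
  shows "C * Im \<tau> \<le> norm (of_real C * \<tau> + of_int d)"
    and "real_of_int \<bar>d\<bar> + 1 \<le> (1 + (norm \<tau> + 1) / Im \<tau>) * norm (of_real C * \<tau> + of_int d)"
proof -
  let ?z = "of_real C * \<tau> + of_int d"
  show 1: "C * Im \<tau> \<le> norm ?z"
    using abs_Im_le_cmod[of ?z] assms by simp
  have "norm (of_int d :: complex) \<le> norm ?z + norm (of_real C * \<tau>)"
    using norm_triangle_ineq4[of ?z "of_real C * \<tau>"] by simp
  then have "real_of_int \<bar>d\<bar> \<le> norm ?z + C * norm \<tau>"
    using assms by (simp add: norm_mult)
  then have "real_of_int \<bar>d\<bar> + 1 \<le> norm ?z + C * (norm \<tau> + 1)"
    using assms by (simp add: algebra_simps)
  also have "C * (norm \<tau> + 1) = (C * Im \<tau>) * ((norm \<tau> + 1) / Im \<tau>)"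
    using assms by simp
  also have "\<dots> \<le> norm ?z * ((norm \<tau> + 1) / Im \<tau>)"
    using 1 assms by (intro mult_right_mono) auto
  finally show "real_of_int \<bar>d\<bar> + 1 \<le> (1 + (norm \<tau> + 1) / Im \<tau>) * norm ?z"
    by (simp add: algebra_simps)
qed

lemma abs_summable_on_int_inverse_squares:
  assumes "Im z > 0"
  shows "(\<lambda>d::int. norm (1 / (z + of_int d)\<^sup>2)) summable_on UNIV"
proof -
  define B where "B = 1 + (norm z + 1) / Im z"
  have B: "B > 0" using assms by (auto simp: B_def add_pos_nonneg)
  show ?thesis
  proof (rule Infinite_Sum.abs_summable_on_comparison_test)
    show "(\<lambda>d::int. norm (B\<^sup>2 * (1 / (real_of_int \<bar>d\<bar> + 1)\<^sup>2))) summable_on UNIV"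
      using summable_on_cmult_right[OF summable_on_int_inverse_squares, of "B\<^sup>2"] by (simp add: abs_mult)
  next
    fix d :: int
    have le: "real_of_int \<bar>d\<bar> + 1 \<le> B * norm (z + of_int d)"
      using lattice_point_bounds(2)[OF assms, of 1 d] by (simp add: B_def)
    have "Im (z + of_int d) \<noteq> 0" using assms by simp
    then have nz: "norm (z + of_int d) > 0" by (metis zero_complex.sel(2) zero_less_norm_iff)
    have "(real_of_int \<bar>d\<bar> + 1)\<^sup>2 \<le> (B * norm (z + of_int d))\<^sup>2"
      using le by (intro power_mono) auto
    then show "norm (1 / (z + of_int d)\<^sup>2) \<le> norm (B\<^sup>2 * (1 / (real_of_int \<bar>d\<bar> + 1)\<^sup>2))"
      using nz by (simp add: norm_divide norm_power field_simps power_mult_distrib)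
  qed
qed

lemma not_Ints_if_Im: "Im z \<noteq> 0 \<Longrightarrow> z \<notin> \<int>"
  by (auto elim!: Ints_cases)

lemma has_sum_suminf_nat:
  fixes f :: "nat \<Rightarrow> 'a :: {comm_monoid_add, t2_space}"
  assumes "f summable_on UNIV"
  shows "(f has_sum suminf f) UNIV"
  using has_sum_infsum[OF assms] has_sum_imp_sums[OF has_sum_infsum[OF assms]] sums_unique by metis

text \<open>
  Both sides equal \<open>(\<pi> / sin \<pi> z)\<^sup>2\<close>: the left one by the reflection formula, the right one
  because \<open>\<Sum> n q^n = q / (1 - q)\<^sup>2\<close>.
\<close>

lemma Lipschitz_formula_2:
  assumes "Im z > 0"
  shows "((\<lambda>d::int. 1 / (z + of_int d)\<^sup>2) has_sum
           (- 4 * of_real pi ^ 2 * (\<Sum>n. of_nat (Suc n) * exp (2 * of_real pi * \<i> * z) ^ Suc n))) UNIV"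
proof -
  let ?q = "exp (2 * of_real pi * \<i> * z)"
  have zn: "z \<notin> \<int>" using assms by (intro not_Ints_if_Im) auto
  have sm: "(\<lambda>d::int. 1 / (z + of_int d)\<^sup>2) summable_on UNIV"
    using abs_summable_on_int_inverse_squares[OF assms] by (rule abs_summable_summable)
  have inj: "inj (\<lambda>n. - int (Suc n))" by (auto simp: inj_def)
  have "(\<lambda>n::nat. 1 / (z + of_nat n)\<^sup>2) summable_on UNIV"
    using summable_on_subset_banach[OF sm, of "range int"] by (simp add: summable_on_reindex o_def)
  moreover have "Polygamma 1 z = (\<Sum>n. 1 / (z + of_nat n)\<^sup>2)"
    by (simp add: Polygamma_def inverse_eq_divide power2_eq_square)
  ultimately have 1: "((\<lambda>n::nat. 1 / (z + of_int (int n))\<^sup>2) has_sum Polygamma 1 z) UNIV"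
    using has_sum_suminf_nat by simp
  have eq: "1 / (z + of_int (- int (Suc n)))\<^sup>2 = 1 / (1 - z + of_nat n)\<^sup>2" for n
  proof -
    have "z + of_int (- int (Suc n)) = - (1 - z + of_nat n)" by simp
    then show ?thesis by (simp only: power2_minus)
  qed
  have "(\<lambda>n::nat. 1 / (1 - z + of_nat n)\<^sup>2) summable_on UNIV"
    using summable_on_subset_banach[OF sm, of "range (\<lambda>n. - int (Suc n))"]
    by (simp only: summable_on_reindex[OF inj] o_def eq) auto
  moreover have "Polygamma 1 (1 - z) = (\<Sum>n. 1 / (1 - z + of_nat n)\<^sup>2)"
    by (simp add: Polygamma_def inverse_eq_divide power2_eq_square)
  ultimately have 2: "((\<lambda>n::nat. 1 / (z + of_int (- int (Suc n)))\<^sup>2) has_sum Polygamma 1 (1 - z)) UNIV"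
    unfolding eq using has_sum_suminf_nat by simp
  have main: "((\<lambda>d::int. 1 / (z + of_int d)\<^sup>2) has_sum (of_real pi / sin (of_real pi * z))\<^sup>2) UNIV"
    using has_sum_int_split[OF 1 2] Polygamma_1_reflection_complex[OF zn] by simp
  have q: "norm ?q < 1" using assms by simp
  have "(\<lambda>n. ?q * (of_nat (Suc n) * ?q ^ n)) sums (?q * (1 / (1 - ?q)\<^sup>2))"
    by (intro sums_mult geometric_deriv_sums q)
  then have S: "(\<Sum>n. of_nat (Suc n) * ?q ^ Suc n) = ?q / (1 - ?q)\<^sup>2"
    by (simp add: sums_iff mult_ac)
  define w where "w = exp (\<i> * (of_real pi * z))"
  have w: "w \<noteq> 0" "?q = w ^ 2"
    unfolding w_def exp_double[symmetric] by (simp_all add: mult_ac)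
  have sin: "sin (of_real pi * z) = (w - 1 / w) / (2 * \<i>)"
    by (simp add: sin_exp_eq w_def exp_minus inverse_eq_divide)
  have "?q \<noteq> 1" using q by (metis norm_one less_irrefl)
  then have ne: "w ^ 2 \<noteq> 1" using w by simp
  then have ne': "w - 1 / w \<noteq> 0" "1 - w ^ 2 \<noteq> 0" using w by (auto simp: field_simps power2_eq_square)
  have "(w - 1 / w)\<^sup>2 = (1 - w ^ 2)\<^sup>2 / w ^ 2"
    using w by (simp add: field_simps power2_eq_square)
  then have "(of_real pi / sin (of_real pi * z))\<^sup>2 = - 4 * of_real pi ^ 2 * (w\<^sup>2 / (1 - w\<^sup>2)\<^sup>2)"
    using w ne' by (simp add: sin power_divide power_mult_distrib)
  then have "(of_real pi / sin (of_real pi * z))\<^sup>2 =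
      - 4 * of_real pi ^ 2 * (\<Sum>n. of_nat (Suc n) * ?q ^ Suc n)"
    unfolding S by (simp only: w(2))
  then show ?thesis using main by (simp only:)
qed

section \<open>Symmetric partial sums over the integers\<close>

lemma filterlim_symmetric_intervals:
  "filterlim (\<lambda>N. {- int N..int N}) (finite_subsets_at_top UNIV) sequentially"
  unfolding filterlim_finite_subsets_at_top
proof (intro allI impI)
  fix X :: "int set" assume "finite X \<and> X \<subseteq> UNIV"
  then have fin: "finite X" by simp
  define M where "M = Max (insert 0 ((\<lambda>x. nat \<bar>x\<bar>) ` X))"
  have M: "nat \<bar>x\<bar> \<le> M" if "x \<in> X" for x
    unfolding M_def using fin that by (intro Max_ge) auto
  show "\<forall>\<^sub>F N in sequentially. finite {- int N..int N} \<and> X \<subseteq> {- int N..int N} \<and> {- int N..int N} \<subseteq> UNIV"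
    using eventually_ge_at_top[of M]
  proof eventually_elim
    case (elim N)
    have "x \<in> {- int N..int N}" if "x \<in> X" for x
      using M[OF that] elim by auto
    then show ?case by auto
  qed
qed

lemma has_sum_int_symmetric_LIMSEQ:
  fixes f :: "int \<Rightarrow> complex"
  assumes "(f has_sum S) UNIV"
  shows "(\<lambda>N. \<Sum>d=- int N..int N. f d) \<longlonglongrightarrow> S"
  using filterlim_compose[OF assms[unfolded has_sum_def] filterlim_symmetric_intervals] .

lemma sum_symmetric_interval_Suc:
  fixes f :: "int \<Rightarrow> 'a :: comm_monoid_add"
  shows "(\<Sum>d=- int (Suc N)..int (Suc N). f d) = (\<Sum>d=- int N..int N. f d) + (f (int (Suc N)) + f (- int (Suc N)))"
proof -
  have "{- int (Suc N)..int (Suc N)} = insert (int (Suc N)) (insert (- int (Suc N)) {- int N..int N})"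
    by auto
  then show ?thesis by (simp add: add_ac)
qed

lemma sum_symmetric_interval:
  fixes f :: "int \<Rightarrow> 'a :: comm_monoid_add"
  shows "(\<Sum>d=- int N..int N. f d) = f 0 + (\<Sum>n<N. f (int (Suc n)) + f (- int (Suc n)))"
proof (induction N)
  case (Suc N)
  then show ?case unfolding sum_symmetric_interval_Suc by (simp add: add_ac)
qed simp

lemma sum_symmetric_telescope:
  fixes g :: "int \<Rightarrow> 'a :: ab_group_add"
  shows "(\<Sum>d=- int N..int N. g (d - 1) - g (d + 1)) =
           g (- int N - 1) + g (- int N) - g (int N) - g (int N + 1)"
proof (induction N)
  case (Suc N)
  have eqs: "int (Suc N) - 1 = int N" "- int (Suc N) + 1 = - int N" "int (Suc N) = int N + 1"
    "- int (Suc N) = - int N - 1" by auto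
  show ?case unfolding sum_symmetric_interval_Suc Suc.IH eqs(1,2) unfolding eqs(3,4) by simp
qed simp

text \<open>
  With \<open>q = exp (-2 \<pi> i z)\<close> the cotangent is \<open>i (1 + q^N) / (1 - q^N)\<close>, and \<open>q^N\<close> tends to 0 in
  the lower half plane.
\<close>

lemma cot_LIMSEQ_lower:
  assumes "Im z < 0"
  shows "(\<lambda>N. cot (of_real pi * (of_nat N * z))) \<longlonglongrightarrow> \<i>"
proof -
  define q where "q = exp (- 2 * of_real pi * \<i> * z)"
  have q: "norm q < 1" using assms by (simp add: q_def mult_pos_neg)
  have "cot (of_real pi * (of_nat N * z)) = \<i> * (1 + q ^ N) / (1 - q ^ N)" for N
  proof -
    define w where "w = exp (\<i> * (of_real pi * (of_nat N * z)))"
    have w: "w \<noteq> 0" "1 / w\<^sup>2 = q ^ N"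
      unfolding w_def q_def exp_double[symmetric] exp_of_nat_mult[symmetric]
      by (simp_all add: exp_minus inverse_eq_divide mult_ac)
    have frac: "(x / 2) / (y / (2 * \<i>)) = \<i> * x / y" for x y
      by (cases "y = 0") (simp_all add: field_simps)
    have "cot (of_real pi * (of_nat N * z)) = ((w + 1 / w) / 2) / ((w - 1 / w) / (2 * \<i>))"
      by (simp add: cot_def sin_exp_eq cos_exp_eq w_def exp_minus inverse_eq_divide)
    also have "\<dots> = \<i> * (w + 1 / w) / (w - 1 / w)"
      by (rule frac)
    also have "w + 1 / w = w * (1 + 1 / w\<^sup>2)" using w(1) by (simp add: field_simps power2_eq_square)
    also have "w - 1 / w = w * (1 - 1 / w\<^sup>2)" using w(1) by (simp add: field_simps power2_eq_square)
    also have "\<i> * (w * (1 + 1 / w\<^sup>2)) / (w * (1 - 1 / w\<^sup>2)) = w * (\<i> * (1 + 1 / w\<^sup>2)) / (w * (1 - 1 / w\<^sup>2))"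
      by (simp only: mult.left_commute)
    also have "\<dots> = \<i> * (1 + 1 / w\<^sup>2) / (1 - 1 / w\<^sup>2)"
      using w(1) by (rule mult_divide_mult_cancel_left)
    finally show ?thesis unfolding w .
  qed
  moreover have "(\<lambda>N. \<i> * (1 + q ^ N) / (1 - q ^ N)) \<longlonglongrightarrow> \<i> * (1 + 0) / (1 - 0)"
    using q by (intro tendsto_intros LIMSEQ_power_zero) auto
  ultimately show ?thesis by simp
qed

lemma lattice_column_difference_sums:
  assumes "Im \<tau> > 0" "N \<ge> 1"
  shows "(\<lambda>c. 1 / (of_nat (Suc c) * \<tau> - of_nat N) - 1 / (of_nat (Suc c) * \<tau> + of_nat N)) sums
           (1 / of_nat N - of_real pi / \<tau> * cot (of_real pi * (of_nat N * (1 / \<tau>))))"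
proof -
  have t: "\<tau> \<noteq> 0" using assms by auto
  have "Im (1 / \<tau>) < 0" using assms t by (simp add: Im_divide divide_neg_pos zero_less_power2 sum_power2_gt_zero_iff)
  moreover have "Im (of_nat N * z) = of_nat N * Im z" for z by simp
  ultimately have "Im (of_nat N * (1 / \<tau>)) \<noteq> 0" using assms(2) by (metis less_irrefl mult_eq_0_iff not_one_le_zero of_nat_eq_0_iff)
  then have "of_nat N * (1 / \<tau>) \<notin> \<int>" by (rule not_Ints_if_Im)
  from sums_mult[OF cot_partial_fractions_sums[OF this], of "1 / \<tau>"]
  have "(\<lambda>c. 1 / \<tau> * (1 / (of_nat (Suc c) - of_nat N * (1 / \<tau>)) - 1 / (of_nat (Suc c) + of_nat N * (1 / \<tau>)))) sums
          (1 / \<tau> * (1 / (of_nat N * (1 / \<tau>)) - of_real pi * cot (of_real pi * (of_nat N * (1 / \<tau>)))))" .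
  moreover have "1 / \<tau> * (1 / (x - y * (1 / \<tau>)) - 1 / (x + y * (1 / \<tau>))) = 1 / (x * \<tau> - y) - 1 / (x * \<tau> + y)" for x y
  proof -
    have "1 / (x * \<tau> - y) = 1 / \<tau> * (1 / (x - y * (1 / \<tau>)))" "1 / (x * \<tau> + y) = 1 / \<tau> * (1 / (x + y * (1 / \<tau>)))"
      using t by (simp_all add: algebra_simps)
    then show ?thesis by (simp add: algebra_simps)
  qed
  moreover have "1 / \<tau> * (1 / (of_nat N * (1 / \<tau>)) - of_real pi * x) = 1 / of_nat N - of_real pi / \<tau> * x" for x
    using t by (simp add: algebra_simps)
  ultimately show ?thesis by (simp only:)
qed

text \<open>
  This nonzero limit is the source of the anomaly of \<open>E\<^sub>2\<close>: it is what remains of a double sum that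
  telescopes to 0 when it is summed in the other order.
\<close>

lemma lattice_column_difference_LIMSEQ:
  assumes "Im \<tau> > 0"
  shows "(\<lambda>N. \<Sum>c. 1 / (of_nat (Suc c) * \<tau> - of_nat N) - 1 / (of_nat (Suc c) * \<tau> + of_nat N))
           \<longlonglongrightarrow> - of_real pi * \<i> / \<tau>"
proof -
  have t: "\<tau> \<noteq> 0" using assms by auto
  have "Im (1 / \<tau>) < 0" using assms t by (simp add: Im_divide divide_neg_pos zero_less_power2 sum_power2_gt_zero_iff)
  then have "(\<lambda>N. 1 / of_nat N - of_real pi / \<tau> * cot (of_real pi * (of_nat N * (1 / \<tau>))))
          \<longlonglongrightarrow> 0 - of_real pi / \<tau> * \<i>"
    by (intro tendsto_intros cot_LIMSEQ_lower lim_1_over_n)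
  moreover have "\<forall>\<^sub>F N in sequentially. 1 / of_nat N - of_real pi / \<tau> * cot (of_real pi * (of_nat N * (1 / \<tau>))) =
      (\<Sum>c. 1 / (of_nat (Suc c) * \<tau> - of_nat N) - 1 / (of_nat (Suc c) * \<tau> + of_nat N))"
    using eventually_ge_at_top[of 1]
    by eventually_elim (rule sums_unique, rule lattice_column_difference_sums[OF assms])
  ultimately show ?thesis by (simp add: tendsto_cong)
qed

section \<open>Interchanging the summations in the lattice sum of weight two\<close>

lemma summable_on_times_product:
  fixes u :: "'a \<Rightarrow> real" and v :: "'b \<Rightarrow> real"
  assumes "u summable_on A" "v summable_on B"
    and "\<And>x. x \<in> A \<Longrightarrow> u x \<ge> 0" "\<And>y. y \<in> B \<Longrightarrow> v y \<ge> 0"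
  shows "(\<lambda>(x, y). u x * v y) summable_on (A \<times> B)"
proof (rule summable_on_SigmaI)
  show "((\<lambda>y. case (x, y) of (x, y) \<Rightarrow> u x * v y) has_sum (u x * infsum v B)) B" for x
    using assms(2) by (auto intro: has_sum_cmult_right)
  show "(\<lambda>x. u x * infsum v B) summable_on A"
    using assms(1) by (rule summable_on_cmult_left)
qed (use assms in auto)

lemma has_sum_diff:
  fixes f g :: "'a \<Rightarrow> complex"
  assumes "(f has_sum S) A" "(g has_sum T) A"
  shows "((\<lambda>x. f x - g x) has_sum (S - T)) A"
  using has_sum_add[OF assms(1) has_sum_uminusI[OF assms(2)]] by simp

lemma has_sum_finite_sum:
  fixes f :: "'i \<Rightarrow> 'a \<Rightarrow> complex"
  assumes "\<And>i. i \<in> I \<Longrightarrow> (f i has_sum S i) A"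
  shows "((\<lambda>x. \<Sum>i\<in>I. f i x) has_sum (\<Sum>i\<in>I. S i)) A"
  using assms by (induction I rule: infinite_finite_induct) (auto intro: has_sum_add)

lemma inverse_shift_LIMSEQ:
  fixes w :: complex
  shows "(\<lambda>N. 1 / (w + of_nat N)) \<longlonglongrightarrow> 0" "(\<lambda>N. 1 / (w - of_nat N)) \<longlonglongrightarrow> 0"
proof -
  have *: "(\<lambda>N. 1 / (w + of_nat N)) \<longlonglongrightarrow> 0" for w :: complex
    unfolding divide_inverse mult_1
    by (intro filterlim_compose[OF tendsto_inverse_0] tendsto_add_filterlim_at_infinity[OF tendsto_const] tendsto_of_nat)
  then show "(\<lambda>N. 1 / (w + of_nat N)) \<longlonglongrightarrow> 0" .
  have "(\<lambda>N. - (1 / (- w + of_nat N))) \<longlonglongrightarrow> - 0"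
    by (intro tendsto_minus *)
  moreover have "- (1 / (- w + of_nat N)) = 1 / (w - of_nat N)" for N
    by (metis minus_diff_eq minus_divide_right add.commute uminus_add_conv_diff)
  ultimately show "(\<lambda>N. 1 / (w - of_nat N)) \<longlonglongrightarrow> 0" by simp
qed

text \<open>
  The double series of \<open>p = 1 / z\<^sup>2\<close>, \<open>z = c \<tau> + d\<close>, does not converge absolutely, but
  \<open>b = 1 / z\<^sup>2 - 1 / (z\<^sup>2 - 1) = -1 / (z\<^sup>2 (z\<^sup>2 - 1))\<close> has an absolutely convergent one, so its
  summations may be interchanged. The difference \<open>a = 1 / (z\<^sup>2 - 1)\<close> telescopes in \<open>d\<close>: its rows sum to
  0, while the sum of its columns over \<open>\<bar>d\<bar> \<le> N\<close> is the average of two consecutive terms of the sequence in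
  \<open>lattice_column_difference_LIMSEQ\<close>. The shift by 1 in both directions, unlike the more common
  \<open>1 / z - 1 / (z + 1)\<close>, keeps everything symmetric in \<open>d\<close>, which suits symmetric partial sums.
\<close>

lemma lattice_sum_swap:
  fixes \<tau> :: complex
  assumes \<tau>: "Im \<tau> > 0"
  defines "p \<equiv> \<lambda>(c::nat) (d::int). 1 / (of_nat (Suc c) * \<tau> + of_int d)\<^sup>2"
  shows "(\<lambda>N. \<Sum>d=- int N..int N. \<Sum>\<^sub>\<infinity>c. p c d) \<longlonglongrightarrow> (\<Sum>\<^sub>\<infinity>c. \<Sum>\<^sub>\<infinity>d. p c d) - of_real pi * \<i> / \<tau>"
proof -
  define z where "z = (\<lambda>(c::nat) (d::int). of_nat (Suc c) * \<tau> + of_int d)"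
  define a where "a = (\<lambda>c d. 1 / ((z c d)\<^sup>2 - 1))"
  define b where "b = (\<lambda>c d. p c d - a c d)"
  define g where "g = (\<lambda>c d. 1 / z c d)"
  define D where "D = 1 + 1 / Im \<tau>"
  define B where "B = (1 + (norm \<tau> + 1) / Im \<tau>) / Im \<tau>"
  have D: "D > 0" and B: "B > 0" using \<tau> by (auto simp: D_def B_def add_pos_nonneg)
  have p_z: "p c d = 1 / (z c d)\<^sup>2" for c d by (simp add: p_def z_def)
  have z_ge: "real (Suc c) * Im \<tau> \<le> norm (z c d)" for c d
    using lattice_point_bounds(1)[OF \<tau>, of "real (Suc c)" d] by (simp add: z_def)
  have z_pos: "norm (z c d) > 0" for c d
    using z_ge[of c d] \<tau> by (smt (verit) mult_pos_pos of_nat_0_less_iff zero_less_Suc)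
  then have z_nz: "z c d \<noteq> 0" for c d by (metis norm_zero less_irrefl)
  have z_shift: "z c (d + 1) = z c d + 1" "z c (d - 1) = z c d - 1" for c d by (auto simp: z_def)
  have sq: "(z c d)\<^sup>2 - 1 = z c (d - 1) * z c (d + 1)" for c d
    unfolding z_shift by (simp add: power2_eq_square algebra_simps)
  have z_ge_Im: "norm (z c d) \<ge> Im \<tau>" for c d
    using z_ge[of c d] \<tau> by (simp add: algebra_simps) (smt (verit) mult_nonneg_nonneg of_nat_0_le_iff)
  have z_prod: "real (Suc c) * (real_of_int \<bar>d\<bar> + 1) \<le> B * (norm (z c d))\<^sup>2" for c d
  proof -
    have "real_of_int \<bar>d\<bar> + 1 \<le> B * Im \<tau> * norm (z c d)"
      using lattice_point_bounds(2)[OF \<tau>, of "real (Suc c)" d] \<tau> by (simp add: z_def B_def)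
    then have "(real (Suc c) * Im \<tau>) * (real_of_int \<bar>d\<bar> + 1) \<le> norm (z c d) * (B * Im \<tau> * norm (z c d))"
      using z_ge[of c d] \<tau> B by (intro mult_mono) auto
    also have "\<dots> = B * (norm (z c d))\<^sup>2 * Im \<tau>" by (simp add: power2_eq_square)
    also have "(real (Suc c) * Im \<tau>) * (real_of_int \<bar>d\<bar> + 1) = real (Suc c) * (real_of_int \<bar>d\<bar> + 1) * Im \<tau>"
      by simp
    finally show ?thesis using \<tau> by simp
  qed
  have z_sq: "(norm (z c d))\<^sup>2 \<le> D\<^sup>2 * norm ((z c d)\<^sup>2 - 1)" for c d
  proof -
    have *: "norm (z c d) \<le> D * norm (z c e)" if "norm (z c d - z c e) = 1" for e
    proof -
      have "norm (z c d) \<le> norm (z c e) + 1"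
        using norm_triangle_ineq[of "z c e" "z c d - z c e"] that by simp
      also have "1 \<le> norm (z c e) / Im \<tau>"
        using z_ge_Im[of c e] \<tau> by simp
      finally show ?thesis by (simp add: D_def algebra_simps)
    qed
    have "norm (z c d) * norm (z c d) \<le> (D * norm (z c (d - 1))) * (D * norm (z c (d + 1)))"
      using D by (intro mult_mono *) (auto simp: z_shift)
    then show ?thesis unfolding sq norm_mult by (simp add: power2_eq_square mult_ac)
  qed
  have a_le: "norm (a c d) \<le> D\<^sup>2 * norm (p c d)" for c d
  proof -
    have "1 / norm ((z c d)\<^sup>2 - 1) \<le> D\<^sup>2 * (1 / (norm (z c d))\<^sup>2)"
      using z_sq[of c d] z_pos[of c d] sq[of c d] z_nz[of c "d + 1"] z_nz[of c "d - 1"]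
      by (simp add: field_simps)
    then show ?thesis by (simp add: a_def p_z norm_divide norm_power)
  qed
  have b_le: "norm (b c d) \<le> D\<^sup>2 * B\<^sup>2 * (1 / (real c + 1)\<^sup>2 * (1 / (real_of_int \<bar>d\<bar> + 1)\<^sup>2))" for c d
  proof -
    have nz: "(z c d)\<^sup>2 - 1 \<noteq> 0" unfolding sq using z_nz by simp
    have "b c d = - (p c d * a c d)"
      using nz z_nz[of c d] by (simp add: b_def a_def p_z field_simps)
    then have "norm (b c d) = norm (p c d) * norm (a c d)" by (simp add: norm_mult)
    also have "\<dots> \<le> norm (p c d) * (D\<^sup>2 * norm (p c d))"
      by (intro mult_left_mono a_le) auto
    also have "\<dots> = D\<^sup>2 * (1 / (norm (z c d))\<^sup>2)\<^sup>2"
      by (simp add: p_z norm_divide norm_power norm_mult power2_eq_square)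
    also have "1 / (norm (z c d))\<^sup>2 \<le> B * (1 / (real (Suc c) * (real_of_int \<bar>d\<bar> + 1)))"
    proof -
      have "real (Suc c) * (real_of_int \<bar>d\<bar> + 1) > 0" by (intro mult_pos_pos) auto
      then show ?thesis using z_prod[of c d] z_pos[of c d] by (simp add: field_simps)
    qed
    then have "D\<^sup>2 * (1 / (norm (z c d))\<^sup>2)\<^sup>2 \<le> D\<^sup>2 * (B * (1 / (real (Suc c) * (real_of_int \<bar>d\<bar> + 1))))\<^sup>2"
      by (intro mult_left_mono power_mono) auto
    also have "\<dots> = D\<^sup>2 * B\<^sup>2 * (1 / (real c + 1)\<^sup>2 * (1 / (real_of_int \<bar>d\<bar> + 1)\<^sup>2))"
      by (simp add: power_mult_distrib power_divide add.commute)
    finally show ?thesis .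
  qed
  have nat_sq: "(\<lambda>c. 1 / (real c + 1)\<^sup>2) summable_on UNIV"
    using has_sum_nat_inverse_Suc_squares by (rule has_sum_imp_summable)
  have "(\<lambda>x. norm ((\<lambda>(c, d). b c d) x)) summable_on UNIV \<times> UNIV"
  proof (rule Infinite_Sum.abs_summable_on_comparison_test)
    have "(\<lambda>x. D\<^sup>2 * B\<^sup>2 * (case x of (c, d) \<Rightarrow> 1 / (real c + 1)\<^sup>2 * (1 / (real_of_int \<bar>d\<bar> + 1)\<^sup>2))) summable_on UNIV \<times> UNIV"
      by (intro summable_on_cmult_right summable_on_times_product nat_sq summable_on_int_inverse_squares) auto
    then show "(\<lambda>x. norm (D\<^sup>2 * B\<^sup>2 * (case x of (c, d) \<Rightarrow> 1 / (real c + 1)\<^sup>2 * (1 / (real_of_int \<bar>d\<bar> + 1)\<^sup>2)))) summable_on UNIV \<times> UNIV"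
      by (simp add: case_prod_unfold)
    show "norm ((\<lambda>(c, d). b c d) x) \<le> norm (D\<^sup>2 * B\<^sup>2 * (case x of (c, d) \<Rightarrow> 1 / (real c + 1)\<^sup>2 * (1 / (real_of_int \<bar>d\<bar> + 1)\<^sup>2)))" for x
      using b_le[of "fst x" "snd x"] by (simp add: case_prod_unfold)
  qed
  then have b_sum: "(\<lambda>(c, d). b c d) summable_on UNIV \<times> UNIV"
    by (rule abs_summable_summable)
  then have b_sum': "(\<lambda>(d, c). b c d) summable_on UNIV \<times> UNIV"
    by (subst (asm) summable_on_swap) simp
  have swap: "(\<Sum>\<^sub>\<infinity>c. \<Sum>\<^sub>\<infinity>d. b c d) = (\<Sum>\<^sub>\<infinity>d. \<Sum>\<^sub>\<infinity>c. b c d)"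
    by (rule infsum_swap_banach[OF b_sum])
  have "((\<lambda>d. \<Sum>\<^sub>\<infinity>c. b c d) has_sum (\<Sum>\<^sub>\<infinity>d. \<Sum>\<^sub>\<infinity>c. b c d)) UNIV"
    by (rule has_sum_infsum, rule summable_on_Sigma_banach[OF b_sum'])
  then have b_lim: "(\<lambda>N. \<Sum>d=- int N..int N. \<Sum>\<^sub>\<infinity>c. b c d) \<longlonglongrightarrow> (\<Sum>\<^sub>\<infinity>c. \<Sum>\<^sub>\<infinity>d. b c d)"
    unfolding swap by (rule has_sum_int_symmetric_LIMSEQ)

  have a_diff: "a c d = (g c (d - 1) - g c (d + 1)) / 2" for c d
  proof -
    have "g c (d - 1) - g c (d + 1) = (z c (d + 1) - z c (d - 1)) / (z c (d - 1) * z c (d + 1))"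
      unfolding g_def using z_nz[of c "d + 1"] z_nz[of c "d - 1"] by (simp add: diff_frac_eq)
    then show ?thesis by (simp add: a_def sq z_shift)
  qed
  have a_part: "(\<Sum>d=- int N..int N. a c d) = (g c (- int N - 1) + g c (- int N) - g c (int N) - g c (int N + 1)) / 2" for c N
    unfolding a_diff sum_divide_distrib[symmetric] sum_symmetric_telescope ..

  have p_row_abs: "(\<lambda>d. norm (p c d)) summable_on UNIV" for c
    unfolding p_def by (rule abs_summable_on_int_inverse_squares) (use \<tau> in \<open>auto intro!: mult_pos_pos\<close>)
  have a_row: "(a c has_sum 0) UNIV" for c
  proof -
    have "(\<lambda>d. norm (a c d)) summable_on UNIV"
    proof (rule Infinite_Sum.abs_summable_on_comparison_test)
      show "(\<lambda>d. norm (D\<^sup>2 * norm (p c d))) summable_on UNIV"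
        using summable_on_cmult_right[OF p_row_abs[of c], of "D\<^sup>2"] by (simp add: abs_mult)
      show "norm (a c d) \<le> norm (D\<^sup>2 * norm (p c d))" for d
        using a_le[of c d] by (simp add: abs_mult)
    qed
    then have "a c summable_on UNIV" by (rule abs_summable_summable)
    then obtain S where S: "(a c has_sum S) UNIV"
      unfolding summable_on_def ..
    have "(\<lambda>N. (g c (- int N - 1) + g c (- int N) - g c (int N) - g c (int N + 1)) / 2) \<longlonglongrightarrow> (0 + 0 - 0 - 0) / 2"
    proof (intro tendsto_intros)
      let ?w = "of_nat (Suc c) * \<tau>"
      have *: "of_int (- int N - 1) = - 1 - (of_nat N :: complex)" "of_int (- int N) = - (of_nat N :: complex)"
        "of_int (int N + 1) = 1 + (of_nat N :: complex)" "of_int (int N) = (of_nat N :: complex)" for N by auto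
      have arith: "x + (- 1 - y) = x - 1 - y" "x + - y = x - y" "x + (1 + y) = x + 1 + y" for x y :: complex
        by auto
      show "(\<lambda>N. g c (- int N - 1)) \<longlonglongrightarrow> 0"
        using inverse_shift_LIMSEQ(2)[of "?w - 1"] unfolding g_def z_def * arith .
      show "(\<lambda>N. g c (- int N)) \<longlonglongrightarrow> 0"
        using inverse_shift_LIMSEQ(2)[of "?w"] unfolding g_def z_def * arith .
      show "(\<lambda>N. g c (int N)) \<longlonglongrightarrow> 0"
        using inverse_shift_LIMSEQ(1)[of "?w"] unfolding g_def z_def * .
      show "(\<lambda>N. g c (int N + 1)) \<longlonglongrightarrow> 0"
        using inverse_shift_LIMSEQ(1)[of "?w + 1"] unfolding g_def z_def * arith .
    qed auto
    moreover have "(\<lambda>N. (g c (- int N - 1) + g c (- int N) - g c (int N) - g c (int N + 1)) / 2) \<longlonglongrightarrow> S"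
      using has_sum_int_symmetric_LIMSEQ[OF S] unfolding a_part .
    ultimately have "(0 + 0 - 0 - 0) / 2 = S" by (rule LIMSEQ_unique)
    then show ?thesis using S by simp
  qed
  have row: "(\<Sum>\<^sub>\<infinity>d. b c d) = (\<Sum>\<^sub>\<infinity>d. p c d)" for c
  proof -
    have "(p c has_sum (\<Sum>\<^sub>\<infinity>d. p c d)) UNIV"
      by (rule has_sum_infsum[OF abs_summable_summable[OF p_row_abs]])
    from has_sum_diff[OF this a_row[of c]] show ?thesis
      unfolding b_def by (simp add: infsumI)
  qed

  have p_col_abs: "(\<lambda>c. norm (p c d)) summable_on UNIV" for d
  proof (rule Infinite_Sum.abs_summable_on_comparison_test)
    show "(\<lambda>c. norm (1 / (Im \<tau>)\<^sup>2 * (1 / (real c + 1)\<^sup>2))) summable_on UNIV"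
      using summable_on_cmult_right[OF nat_sq, of "1 / (Im \<tau>)\<^sup>2"] by (simp add: abs_mult)
    show "norm (p c d) \<le> norm (1 / (Im \<tau>)\<^sup>2 * (1 / (real c + 1)\<^sup>2))" for c
    proof -
      have "(real (Suc c) * Im \<tau>)\<^sup>2 \<le> (norm (z c d))\<^sup>2"
        using \<tau> by (intro power_mono z_ge) auto
      moreover have "real (Suc c) * Im \<tau> > 0" using \<tau> by simp
      ultimately have "1 / (norm (z c d))\<^sup>2 \<le> 1 / (real (Suc c) * Im \<tau>)\<^sup>2"
        using z_pos[of c d] \<tau> by (intro divide_left_mono mult_pos_pos zero_less_power) auto
      then show ?thesis by (simp add: p_z norm_divide norm_power power_mult_distrib mult_ac add.commute)
    qed
  qed
  have p_col: "((\<lambda>c. p c d) has_sum (\<Sum>\<^sub>\<infinity>c. p c d)) UNIV" for d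
    by (rule has_sum_infsum[OF abs_summable_summable[OF p_col_abs]])
  have a_col: "((\<lambda>c. a c d) has_sum (\<Sum>\<^sub>\<infinity>c. a c d)) UNIV" for d
  proof (rule has_sum_infsum, rule abs_summable_summable, rule Infinite_Sum.abs_summable_on_comparison_test)
    show "(\<lambda>c. norm (D\<^sup>2 * norm (p c d))) summable_on UNIV"
      using summable_on_cmult_right[OF p_col_abs[of d], of "D\<^sup>2"] by (simp add: abs_mult)
    show "norm (a c d) \<le> norm (D\<^sup>2 * norm (p c d))" for c
      using a_le[of c d] by (simp add: abs_mult)
  qed
  have col: "(\<Sum>\<^sub>\<infinity>c. p c d) = (\<Sum>\<^sub>\<infinity>c. a c d) + (\<Sum>\<^sub>\<infinity>c. b c d)" for d
    using has_sum_diff[OF p_col[of d] a_col[of d]] unfolding b_def by (simp add: infsumI)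

  define t where "t = (\<lambda>N. \<Sum>c. 1 / (of_nat (Suc c) * \<tau> - of_nat N) - 1 / (of_nat (Suc c) * \<tau> + of_nat N))"
  have t: "t \<longlonglongrightarrow> - of_real pi * \<i> / \<tau>"
    unfolding t_def by (rule lattice_column_difference_LIMSEQ[OF \<tau>])
  have a_cols: "(\<Sum>d=- int N..int N. \<Sum>\<^sub>\<infinity>c. a c d) = (t N + t (Suc N)) / 2" if "N \<ge> 1" for N
  proof -
    have t_sums: "(\<lambda>c. g c (- int M) - g c (int M)) sums t M" if "M \<ge> 1" for M
      using sums_summable[OF lattice_column_difference_sums[OF \<tau> that]]
      unfolding t_def g_def z_def by (simp add: summable_sums del: of_nat_Suc)
    have "((\<lambda>c. \<Sum>d=- int N..int N. a c d) has_sum (\<Sum>d=- int N..int N. \<Sum>\<^sub>\<infinity>c. a c d)) UNIV"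
      by (intro has_sum_finite_sum a_col)
    then have s1: "(\<lambda>c. \<Sum>d=- int N..int N. a c d) sums (\<Sum>d=- int N..int N. \<Sum>\<^sub>\<infinity>c. a c d)"
      by (rule has_sum_imp_sums)
    have s2: "(\<lambda>c. ((g c (- int N) - g c (int N)) + (g c (- int (Suc N)) - g c (int (Suc N)))) / 2) sums ((t N + t (Suc N)) / 2)"
      using that by (intro sums_divide sums_add t_sums) auto
    have eq: "((g c (- int N) - g c (int N)) + (g c (- int (Suc N)) - g c (int (Suc N)))) / 2 = (\<Sum>d=- int N..int N. a c d)" for c
    proof -
      have eqs: "- int (Suc N) = - int N - 1" "int (Suc N) = int N + 1" by auto
      have arith: "(x - y) + (u - v) = u + x - y - v" for x y u v :: complex by simp
      show ?thesis unfolding a_part eqs(1) unfolding eqs(2) arith ..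
    qed
    show ?thesis using s1 s2[unfolded eq] by (rule sums_unique2)
  qed
  have half: "(x + x) / 2 = x" for x :: complex by simp
  have "(\<lambda>N. (t N + t (Suc N)) / 2) \<longlonglongrightarrow> (- of_real pi * \<i> / \<tau> + - of_real pi * \<i> / \<tau>) / 2"
    using t by (intro tendsto_intros LIMSEQ_Suc) auto
  moreover have "\<forall>\<^sub>F N in sequentially. (t N + t (Suc N)) / 2 = (\<Sum>d=- int N..int N. \<Sum>\<^sub>\<infinity>c. a c d)"
    using eventually_ge_at_top[of 1] by eventually_elim (simp add: a_cols)
  ultimately have "(\<lambda>N. \<Sum>d=- int N..int N. \<Sum>\<^sub>\<infinity>c. a c d) \<longlonglongrightarrow> - of_real pi * \<i> / \<tau>"
    by (simp only: tendsto_cong half)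
  from tendsto_add[OF this b_lim] show ?thesis
    unfolding col row sum.distrib by simp
qed

section \<open>The Lambert series of E2 and its inversion formula\<close>

lemma sigma1_Suc_eq: "sigma1 (Suc r) = (\<Sum>n | Suc n dvd Suc r. Suc n)"
proof -
  have "{d. d dvd Suc r} = Suc ` {n. Suc n dvd Suc r}"
  proof (intro equalityI subsetI)
    fix d assume "d \<in> {d. d dvd Suc r}"
    then show "d \<in> Suc ` {n. Suc n dvd Suc r}" by (cases d) auto
  qed auto
  then show ?thesis by (simp add: sigma1_def sum.reindex)
qed

lemma finite_Suc_dvd: "finite {n. Suc n dvd Suc r}"
proof (rule finite_subset)
  show "{n. Suc n dvd Suc r} \<subseteq> {..r}" by (auto dest: dvd_imp_le)
qed simp

lemma Lambert_series_summable:
  fixes q :: complex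
  assumes "norm q < 1"
  shows "(\<lambda>(c, n). of_nat (Suc n) * q ^ (Suc c * Suc n)) summable_on UNIV \<times> UNIV"
proof (rule abs_summable_summable, rule Infinite_Sum.abs_summable_on_comparison_test)
  let ?x = "norm q"
  have "summable (\<lambda>c. ?x ^ c)" using assms by (simp add: summable_geometric)
  then have 1: "(\<lambda>c. ?x ^ c) summable_on UNIV"
    by (intro norm_summable_imp_summable_on) auto
  have "summable (\<lambda>n. real (Suc n) * ?x ^ n)"
    using geometric_deriv_sums[of ?x] assms by (auto simp: sums_iff)
  then have 2: "(\<lambda>n. real (Suc n) * ?x ^ n) summable_on UNIV"
    by (intro norm_summable_imp_summable_on) (auto simp: abs_mult simp del: of_nat_Suc)
  have "(\<lambda>(c, n). ?x ^ c * (real (Suc n) * ?x ^ n)) summable_on UNIV \<times> UNIV"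
    by (intro summable_on_times_product 1 2) auto
  then show "(\<lambda>x. norm ((\<lambda>(c, n). ?x ^ c * (real (Suc n) * ?x ^ n)) x)) summable_on UNIV \<times> UNIV"
    by (simp add: case_prod_unfold abs_mult)
  show "norm ((\<lambda>(c, n). of_nat (Suc n) * q ^ (Suc c * Suc n)) x) \<le>
        norm ((\<lambda>(c, n). ?x ^ c * (real (Suc n) * ?x ^ n)) x)" for x :: "nat \<times> nat"
  proof (cases x)
    case (Pair c n)
    have "?x ^ (Suc c * Suc n) \<le> ?x ^ (c + n)"
      using assms by (intro power_decreasing) auto
    then have "real (Suc n) * ?x ^ (Suc c * Suc n) \<le> real (Suc n) * (?x ^ c * ?x ^ n)"
      by (intro mult_left_mono) (auto simp: power_add)
    then show ?thesis
      by (simp add: Pair norm_mult norm_power abs_mult mult_ac del: of_nat_Suc mult_Suc mult_Suc_right)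
  qed
qed

text \<open>
  The map \<open>(c, n) \<mapsto> (c n, n)\<close> on pairs of positive integers groups the double series by the value
  of the exponent. All indices are shifted by 1, which accounts for the successors.
\<close>

lemma Lambert_series:
  fixes q :: complex
  assumes "norm q < 1"
  shows "((\<lambda>r. of_nat (sigma1 (Suc r)) * q ^ Suc r) has_sum
           (\<Sum>\<^sub>\<infinity>c. \<Sum>n. of_nat (Suc n) * (q ^ Suc c) ^ Suc n)) UNIV"
proof -
  define F where "F = (\<lambda>(c::nat, n). of_nat (Suc n) * q ^ (Suc c * Suc n))"
  have F: "F summable_on UNIV \<times> UNIV" unfolding F_def by (rule Lambert_series_summable[OF assms])
  define S where "S = infsum F (UNIV \<times> UNIV)"
  have S: "(F has_sum S) (UNIV \<times> UNIV)" unfolding S_def using F by (rule has_sum_infsum)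
  have "((\<lambda>n. F (c, n)) has_sum (\<Sum>n. of_nat (Suc n) * (q ^ Suc c) ^ Suc n)) UNIV" for c
  proof -
    have "(\<lambda>n. of_nat (Suc n) * q ^ (Suc c * Suc n)) summable_on UNIV"
      by (rule summable_on_SigmaD1[OF Lambert_series_summable[OF assms]]) simp
    from has_sum_suminf_nat[OF this] show ?thesis
      unfolding F_def by (simp only: case_prod_conv power_mult)
  qed
  then have "((\<lambda>c. \<Sum>n. of_nat (Suc n) * (q ^ Suc c) ^ Suc n) has_sum S) UNIV"
    by (rule has_sum_SigmaD[OF S])
  then have S_eq: "(\<Sum>\<^sub>\<infinity>c. \<Sum>n. of_nat (Suc n) * (q ^ Suc c) ^ Suc n) = S"
    by (rule infsumI)
  let ?D = "SIGMA r:UNIV. {n. Suc n dvd Suc r}"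
  have "((\<lambda>(r, n). of_nat (Suc n) * q ^ Suc r) has_sum S) ?D \<longleftrightarrow> (F has_sum S) (UNIV \<times> UNIV)"
  proof (rule has_sum_reindex_bij_witness[where
        i = "\<lambda>(c, n). (Suc c * Suc n - 1, n)" and j = "\<lambda>(r, n). (Suc r div Suc n - 1, n)"])
    fix a assume "a \<in> ?D"
    then obtain r n where a: "a = (r, n)" "Suc n dvd Suc r" by auto
    then obtain k where k: "Suc r = Suc n * k" by (elim dvdE)
    then have "k > 0" by (cases k) auto
    have r: "Suc r div Suc n = k" unfolding k by (rule nonzero_mult_div_cancel_left) simp
    have "Suc (k - 1) * Suc n = Suc r" using \<open>k > 0\<close> k by (simp add: mult.commute)
    then show "(\<lambda>(c, n). (Suc c * Suc n - 1, n)) ((\<lambda>(r, n). (Suc r div Suc n - 1, n)) a) = a"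
      and "F ((\<lambda>(r, n). (Suc r div Suc n - 1, n)) a) = (\<lambda>(r, n). of_nat (Suc n) * q ^ Suc r) a"
      unfolding a F_def case_prod_conv r by (simp_all only: diff_Suc_1)
  next
    fix b :: "nat \<times> nat"
    obtain c n where b: "b = (c, n)" by (cases b)
    have *: "Suc (Suc c * Suc n - 1) = Suc c * Suc n" by simp
    have "Suc c * Suc n div Suc n = Suc c" by (rule nonzero_mult_div_cancel_right) simp
    then show "(\<lambda>(r, n). (Suc r div Suc n - 1, n)) ((\<lambda>(c, n). (Suc c * Suc n - 1, n)) b) = b"
      unfolding b case_prod_conv * by (simp only: diff_Suc_1)
    show "(\<lambda>(c, n). (Suc c * Suc n - 1, n)) b \<in> ?D"
      unfolding b case_prod_conv mem_Sigma_iff mem_Collect_eq * by (intro conjI UNIV_I dvd_triv_right)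
  qed auto
  with S have D: "((\<lambda>(r, n). of_nat (Suc n) * q ^ Suc r) has_sum S) ?D" by simp
  have "((\<lambda>r. of_nat (sigma1 (Suc r)) * q ^ Suc r) has_sum S) UNIV"
  proof (rule has_sum_SigmaD[OF D])
    fix r :: nat
    have "((\<lambda>n. of_nat (Suc n) * q ^ Suc r) has_sum (\<Sum>n | Suc n dvd Suc r. of_nat (Suc n) * q ^ Suc r)) {n. Suc n dvd Suc r}"
      by (rule has_sum_finite[OF finite_Suc_dvd])
    moreover have "(\<Sum>n | Suc n dvd Suc r. of_nat (Suc n) * q ^ Suc r) = of_nat (sigma1 (Suc r)) * q ^ Suc r"
      unfolding sigma1_Suc_eq of_nat_sum sum_distrib_right ..
    ultimately show "((\<lambda>n. (\<lambda>(r, n). of_nat (Suc n) * q ^ Suc r) (r, n)) has_sum of_nat (sigma1 (Suc r)) * q ^ Suc r) {n. Suc n dvd Suc r}"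
      by simp
  qed
  then show ?thesis unfolding S_eq .
qed

lemma norm_nome_less_1: "Im \<tau> > 0 \<Longrightarrow> norm (exp (2 * of_real pi * \<i> * \<tau>)) < 1"
  by simp

lemma E2_eq_nome_series:
  "E2 \<tau> = 1 - 24 * (\<Sum>r. of_nat (sigma1 (Suc r)) * exp (2 * of_real pi * \<i> * \<tau>) ^ Suc r)"
proof -
  have "exp (2 * of_real pi * \<i> * of_nat (Suc r) * \<tau>) = exp (2 * of_real pi * \<i> * \<tau>) ^ Suc r" for r
    by (simp add: exp_of_nat_mult[symmetric] mult_ac del: of_nat_Suc power_Suc)
  then show ?thesis unfolding E2_def by (simp only:)
qed

text \<open>
  Only positive \<open>c\<close> are summed; the terms \<open>\<plusminus>c\<close> of the Eisenstein series agree, and the missing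
  row \<open>c = 0\<close> is the 1 that is subtracted from \<open>E\<^sub>2\<close>.
\<close>

lemma E2_lattice_sum:
  assumes "Im \<tau> > 0"
  shows "((\<lambda>c. \<Sum>\<^sub>\<infinity>d::int. 1 / (of_nat (Suc c) * \<tau> + of_int d)\<^sup>2) has_sum
           (of_real pi ^ 2 / 6 * (E2 \<tau> - 1))) UNIV"
proof -
  let ?q = "exp (2 * of_real pi * \<i> * \<tau>)"
  let ?L = "\<lambda>c. \<Sum>n. of_nat (Suc n) * (?q ^ Suc c) ^ Suc n"
  have row: "(\<Sum>\<^sub>\<infinity>d::int. 1 / (of_nat (Suc c) * \<tau> + of_int d)\<^sup>2) = - 4 * of_real pi ^ 2 * ?L c" for c
  proof -
    have im: "Im (of_nat (Suc c) * \<tau>) > 0" using assms by (simp del: of_nat_Suc)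
    have eq: "exp (2 * of_real pi * \<i> * (of_nat (Suc c) * \<tau>)) = ?q ^ Suc c"
      by (simp add: exp_of_nat_mult[symmetric] mult_ac del: of_nat_Suc power_Suc)
    show ?thesis using infsumI[OF Lipschitz_formula_2[OF im]] unfolding eq .
  qed
  have L: "(?L has_sum (\<Sum>\<^sub>\<infinity>c. ?L c)) UNIV"
  proof -
    have "(\<lambda>c. \<Sum>\<^sub>\<infinity>n. of_nat (Suc n) * ?q ^ (Suc c * Suc n)) summable_on UNIV"
      by (rule summable_on_Sigma_banach[OF Lambert_series_summable[OF norm_nome_less_1[OF assms]]])
    moreover have "(\<Sum>\<^sub>\<infinity>n. of_nat (Suc n) * ?q ^ (Suc c * Suc n)) = ?L c" for c
    proof -
      have "(\<lambda>n. of_nat (Suc n) * ?q ^ (Suc c * Suc n)) summable_on UNIV"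
        by (rule summable_on_SigmaD1[OF Lambert_series_summable[OF norm_nome_less_1[OF assms]]]) simp
      from infsumI[OF has_sum_suminf_nat[OF this]] show ?thesis by (simp only: power_mult)
    qed
    ultimately show ?thesis by simp
  qed
  have "(\<Sum>r. of_nat (sigma1 (Suc r)) * ?q ^ Suc r) = (\<Sum>\<^sub>\<infinity>c. ?L c)"
    using has_sum_imp_sums[OF Lambert_series[OF norm_nome_less_1[OF assms]]] by (rule sums_unique[symmetric])
  then have total: "- 4 * of_real pi ^ 2 * (\<Sum>\<^sub>\<infinity>c. ?L c) = of_real pi ^ 2 / 6 * (E2 \<tau> - 1)"
    unfolding E2_eq_nome_series by simp
  show ?thesis
    using has_sum_cmult_right[OF L, of "- 4 * of_real pi ^ 2"] unfolding row total .
qed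

lemma has_sum_int_symmetric_split:
  fixes f :: "int \<Rightarrow> complex"
  assumes "((\<lambda>n. f (int (Suc n))) has_sum a) UNIV" "((\<lambda>n. f (- int (Suc n))) has_sum b) UNIV"
  shows "(f has_sum (f 0 + a + b)) UNIV"
proof (rule has_sum_int_split[OF _ assms(2)])
  have "((\<lambda>n. f (int n)) has_sum a) (range Suc)"
    using assms(1) by (subst has_sum_reindex) (auto simp: o_def)
  then have "((\<lambda>n. f (int n)) has_sum (f (int 0) + a)) (insert 0 (range Suc))"
    by (intro has_sum_insert) auto
  then show "((\<lambda>n. f (int n)) has_sum (f 0 + a)) UNIV"
    by (simp add: UNIV_nat_eq[symmetric])
qed

text \<open>
  Multiplying numerator and denominator by \<open>\<tau>\<close> turns the lattice sum for \<open>-1 / \<tau>\<close> into the one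
  for \<open>\<tau>\<close> with the roles of rows and columns exchanged, up to the terms with \<open>c = 0\<close> or \<open>d = 0\<close>, which
  are sums of inverse squares.
\<close>

theorem E2_inversion:
  assumes \<tau>: "Im \<tau> > 0"
  shows "E2 (- 1 / \<tau>) = \<tau>\<^sup>2 * E2 \<tau> - 6 * \<i> * \<tau> / of_real pi"
proof -
  define \<tau>' where "\<tau>' = - 1 / \<tau>"
  have t0: "\<tau> \<noteq> 0" using \<tau> by auto
  have \<tau>': "Im \<tau>' > 0"
    using \<tau> t0 by (simp add: \<tau>'_def Im_divide sum_power2_gt_zero_iff complex_eq_iff)
  define p where "p = (\<lambda>(c::nat) (d::int). 1 / (of_nat (Suc c) * \<tau> + of_int d)\<^sup>2)"
  define U where "U = (\<lambda>d. \<Sum>\<^sub>\<infinity>c. p c d)"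
  define R' where "R' = (\<lambda>n. \<Sum>\<^sub>\<infinity>d::int. 1 / (of_nat (Suc n) * \<tau>' + of_int d)\<^sup>2)"
  have squares: "((\<lambda>n. 1 / (of_nat (Suc n) :: complex)\<^sup>2) has_sum of_real (pi\<^sup>2 / 6)) UNIV"
    using has_sum_of_real[OF has_sum_nat_inverse_Suc_squares, where ?'a = complex] by (simp add: add.commute)
  have lim: "(\<lambda>N. \<Sum>d=- int N..int N. U d) \<longlonglongrightarrow> of_real pi ^ 2 / 6 * (E2 \<tau> - 1) - of_real pi * \<i> / \<tau>"
    using lattice_sum_swap[OF \<tau>] unfolding infsumI[OF E2_lattice_sum[OF \<tau>]] U_def p_def .
  have U0: "U 0 = of_real (pi\<^sup>2 / 6) / \<tau>\<^sup>2"
    using infsumI[OF has_sum_cmult_right[OF squares, of "1 / \<tau>\<^sup>2"]]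
    by (simp add: U_def p_def power_mult_distrib mult_ac)
  have R': "R' n / \<tau>\<^sup>2 - 1 / (of_nat (Suc n))\<^sup>2 = U (int (Suc n)) + U (- int (Suc n))" for n
  proof -
    define f where "f = (\<lambda>d::int. 1 / (of_nat (Suc n) * \<tau>' + of_int d)\<^sup>2)"
    have fsum: "f summable_on UNIV"
      unfolding f_def using \<tau>' by (intro abs_summable_summable[OF abs_summable_on_int_inverse_squares]) (auto intro!: mult_pos_pos)
    have f: "f d = \<tau>\<^sup>2 * (1 / (of_int d * \<tau> - of_nat (Suc n))\<^sup>2)" for d
    proof -
      have "of_nat (Suc n) * \<tau>' + of_int d = (of_int d * \<tau> - of_nat (Suc n)) / \<tau>"
        using t0 by (simp add: \<tau>'_def field_simps)
      then show ?thesis by (simp add: f_def power_divide)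
    qed
    have f1: "f (int (Suc c)) = \<tau>\<^sup>2 * p c (- int (Suc n))" for c
    proof -
      have "of_int (int (Suc c)) * \<tau> - of_nat (Suc n) = of_nat (Suc c) * \<tau> + of_int (- int (Suc n))"
        by (simp add: algebra_simps)
      then show ?thesis unfolding f p_def by (simp only:)
    qed
    have f2: "f (- int (Suc c)) = \<tau>\<^sup>2 * p c (int (Suc n))" for c
    proof -
      have "of_int (- int (Suc c)) * \<tau> - of_nat (Suc n) = - (of_nat (Suc c) * \<tau> + of_int (int (Suc n)))"
        by (simp add: algebra_simps)
      then show ?thesis unfolding f p_def by (simp only: power2_minus)
    qed
    have inj: "inj (\<lambda>n. int (Suc n))" "inj (\<lambda>n. - int (Suc n))" by (auto simp: inj_def)
    have "(\<lambda>c. f (int (Suc c))) summable_on UNIV"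
      using summable_on_subset_banach[OF fsum, of "range (\<lambda>n. int (Suc n))"] summable_on_reindex[OF inj(1), of f] by (simp add: o_def)
    then have s1: "((\<lambda>c. f (int (Suc c))) has_sum (\<tau>\<^sup>2 * U (- int (Suc n)))) UNIV"
      unfolding U_def f1 infsum_cmult_right'[symmetric] by (rule has_sum_infsum)
    have "(\<lambda>c. f (- int (Suc c))) summable_on UNIV"
      using summable_on_subset_banach[OF fsum, of "range (\<lambda>n. - int (Suc n))"] summable_on_reindex[OF inj(2), of f] by (simp add: o_def)
    then have s2: "((\<lambda>c. f (- int (Suc c))) has_sum (\<tau>\<^sup>2 * U (int (Suc n)))) UNIV"
      unfolding U_def f2 infsum_cmult_right'[symmetric] by (rule has_sum_infsum)
    have "R' n = f 0 + \<tau>\<^sup>2 * U (- int (Suc n)) + \<tau>\<^sup>2 * U (int (Suc n))"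
      unfolding R'_def f_def[symmetric] by (rule infsumI[OF has_sum_int_symmetric_split[OF s1 s2]])
    moreover have "f 0 = \<tau>\<^sup>2 * (1 / (of_nat (Suc n))\<^sup>2)"
      unfolding f by (simp only: of_int_0 mult_zero_left diff_0 power2_minus)
    ultimately show ?thesis using t0 by (simp add: field_simps del: of_nat_Suc)
  qed
  have "(\<lambda>n. R' n / \<tau>\<^sup>2 - 1 / (of_nat (Suc n))\<^sup>2) sums
          (of_real pi ^ 2 / 6 * (E2 \<tau>' - 1) / \<tau>\<^sup>2 - of_real (pi\<^sup>2 / 6))"
    unfolding R'_def
    by (intro sums_diff sums_divide has_sum_imp_sums[OF squares] has_sum_imp_sums[OF E2_lattice_sum[OF \<tau>']])
  then have "(\<lambda>N. U 0 + (\<Sum>n<N. U (int (Suc n)) + U (- int (Suc n)))) \<longlonglongrightarrow>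
          U 0 + (of_real pi ^ 2 / 6 * (E2 \<tau>' - 1) / \<tau>\<^sup>2 - of_real (pi\<^sup>2 / 6))"
    unfolding R' sums_def by (intro tendsto_add tendsto_const)
  then have "of_real pi ^ 2 / 6 * (E2 \<tau> - 1) - of_real pi * \<i> / \<tau> =
      U 0 + (of_real pi ^ 2 / 6 * (E2 \<tau>' - 1) / \<tau>\<^sup>2 - of_real (pi\<^sup>2 / 6))"
    using lim unfolding sum_symmetric_interval by (rule LIMSEQ_unique[symmetric])
  then have eq: "of_real pi ^ 2 / 6 * E2 \<tau> - of_real pi * \<i> / \<tau> = of_real pi ^ 2 / 6 * E2 \<tau>' / \<tau>\<^sup>2"
    unfolding U0 by (simp add: right_diff_distrib diff_divide_distrib)
  have "E2 \<tau>' = \<tau>\<^sup>2 * 6 / of_real pi ^ 2 * (of_real pi ^ 2 / 6 * E2 \<tau>' / \<tau>\<^sup>2)"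
    using t0 by simp
  also have "\<dots> = \<tau>\<^sup>2 * E2 \<tau> - 6 * \<i> * \<tau> / of_real pi"
    unfolding eq[symmetric] using t0 by (simp add: field_simps power2_eq_square)
  finally show ?thesis by (simp add: \<tau>'_def)
qed

section \<open>The action of SL(2, Z) on E2\<close>

lemma Im_fractional_linear:
  fixes a b c d :: int
  assumes "a * d - b * c = 1" "Im \<tau> > 0"
  shows "of_int c * \<tau> + of_int d \<noteq> 0"
    and "Im ((of_int a * \<tau> + of_int b) / (of_int c * \<tau> + of_int d)) > 0"
proof -
  let ?J = "of_int c * \<tau> + of_int d"
  show nz: "?J \<noteq> 0"
  proof
    assume J: "?J = 0"
    then have "Im ?J = 0" by simp
    then have "c = 0" using assms(2) by simp
    with J assms(1) show False by simp
  qed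
  have "Im ((of_int a * \<tau> + of_int b) / ?J) = Im ((of_int a * \<tau> + of_int b) * cnj ?J) / (norm ?J)\<^sup>2"
    by (subst complex_div_cnj) (simp only: Im_divide_of_real flip: of_real_power)
  also have "Im ((of_int a * \<tau> + of_int b) * cnj ?J) = of_int (a * d - b * c) * Im \<tau>"
    by (simp add: algebra_simps)
  finally show "Im ((of_int a * \<tau> + of_int b) / ?J) > 0"
    using assms nz by simp
qed

lemma E2_shift: "E2 (\<tau> + of_int b) = E2 \<tau>"
proof -
  have "exp (2 * of_real pi * \<i> * (\<tau> + of_int b)) = exp (2 * of_real pi * \<i> * \<tau>) * exp (2 * of_int b * of_real pi * \<i>)"
    by (simp add: exp_add[symmetric] algebra_simps)
  also have "exp (2 * of_int b * of_real pi * \<i>) = 1"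
    by (auto simp: exp_eq_1)
  finally show ?thesis unfolding E2_eq_nome_series by simp
qed

text \<open>
  Euclidean algorithm on the left column: with \<open>a = q c + r\<close> the matrix is the product of the
  translation by \<open>q\<close>, the inversion, and a matrix with lower left entry \<open>r\<close>, where \<open>\<bar>r\<bar> < \<bar>c\<bar>\<close>.
\<close>

lemma E2_fractional_linear:
  fixes a b c d :: int
  assumes "a * d - b * c = 1" "Im \<tau> > 0"
  shows "E2 ((of_int a * \<tau> + of_int b) / (of_int c * \<tau> + of_int d)) =
           (of_int c * \<tau> + of_int d)\<^sup>2 * E2 \<tau> - 6 * \<i> * of_int c * (of_int c * \<tau> + of_int d) / of_real pi"
  using assms(1)
proof (induction "nat \<bar>c\<bar>" arbitrary: a b c d rule: less_induct)
  case less
  show ?case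
  proof (cases "c = 0")
    case True
    then have "a = 1 \<and> d = 1 \<or> a = -1 \<and> d = -1"
      using less.prems by (simp add: zmult_eq_1_iff)
    then show ?thesis
    proof
      assume "a = 1 \<and> d = 1"
      with True show ?thesis using E2_shift[of \<tau> b] by simp
    next
      assume "a = -1 \<and> d = -1"
      with True show ?thesis using E2_shift[of \<tau> "- b"] by simp
    qed
  next
    case False
    define q where "q = a div c"
    define r where "r = a mod c"
    define b' where "b' = b - q * d"
    have a: "a = q * c + r" by (simp add: q_def r_def)
    have b: "b = b' + q * d" by (simp add: b'_def)
    have det: "r * d - b' * c = 1" using less.prems unfolding a b by (simp add: algebra_simps)
    have det': "- c * b' - - d * r = 1" using det by (simp add: algebra_simps)
    define J where "J = of_int c * \<tau> + of_int d"
    define J' where "J' = of_int r * \<tau> + of_int b'"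
    \<comment> \<open>The point \<open>\<tau>'\<close> is the image of \<open>\<tau>\<close> under the remaining matrix; then \<open>-1 / \<tau>'\<close> and the point to be treated differ by \<open>q\<close>.\<close>
    define \<tau>' where "\<tau>' = (of_int (- c) * \<tau> + of_int (- d)) / J'"
    have J: "J \<noteq> 0" unfolding J_def using Im_fractional_linear(1)[OF less.prems assms(2)] .
    have J': "J' \<noteq> 0" unfolding J'_def using Im_fractional_linear(1)[OF det' assms(2)] .
    have \<tau>': "Im \<tau>' > 0" unfolding \<tau>'_def J'_def using Im_fractional_linear(2)[OF det' assms(2)] .
    have "of_int (- c) * \<tau> + of_int (- d) = - J" by (simp add: J_def)
    then have \<tau>'_eq: "\<tau>' = - (J / J')" by (simp add: \<tau>'_def)
    have "nat \<bar>r\<bar> < nat \<bar>c\<bar>" using False abs_mod_less[of c a] by (simp add: r_def)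
    from less.hyps[OF this det'] have IH: "E2 \<tau>' = J'\<^sup>2 * E2 \<tau> - 6 * \<i> * of_int r * J' / of_real pi"
      unfolding \<tau>'_def J'_def .
    have key: "of_int r * J - 1 = of_int c * J'"
    proof -
      have "of_int r * J - of_int c * J' = of_int (r * d - b' * c)"
        by (simp add: J_def J'_def algebra_simps)
      then show ?thesis unfolding det by (simp add: algebra_simps)
    qed
    have "(of_int a * \<tau> + of_int b) / J = - 1 / \<tau>' + of_int q"
    proof -
      have "of_int a * \<tau> + of_int b = J' + of_int q * J"
        by (simp add: a b J_def J'_def algebra_simps)
      then show ?thesis using J J' by (simp add: \<tau>'_eq add_divide_distrib)
    qed
    then have "E2 ((of_int a * \<tau> + of_int b) / J) = \<tau>'\<^sup>2 * E2 \<tau>' - 6 * \<i> * \<tau>' / of_real pi"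
      by (simp only: E2_shift E2_inversion[OF \<tau>'])
    also have "\<dots> = J\<^sup>2 * E2 \<tau> - 6 * \<i> / of_real pi * (J / J' * (of_int r * J - 1))"
      unfolding IH unfolding \<tau>'_eq using J J' by (simp add: field_simps power2_eq_square)
    also have "\<dots> = J\<^sup>2 * E2 \<tau> - 6 * \<i> * of_int c * J / of_real pi"
      unfolding key using J' by simp
    finally show ?thesis unfolding J_def .
  qed
qed

lemma det_SL2Z: "A \<in> carrier SL2Z \<Longrightarrow> A$1$1 * A$2$2 - A$1$2 * A$2$1 = 1"
  by (simp add: SL2Z_def det_2)

text \<open>
  Half the logarithmic derivative of the derivative of the action, up to sign; the parameter \<open>K\<close> of
  the functional equation.
\<close>

definition cocycle :: "int^2^2 \<Rightarrow> complex \<Rightarrow> complex" where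
  "cocycle A \<tau> = of_int (A$2$1) / automorphy_factor A \<tau>"

lemma automorphy_factor_nonzero:
  "A \<in> carrier SL2Z \<Longrightarrow> \<tau> \<in> upper_half_plane \<Longrightarrow> automorphy_factor A \<tau> \<noteq> 0"
  unfolding automorphy_factor_def upper_half_plane_def
  using Im_fractional_linear(1)[OF det_SL2Z] by simp

lemma moebius_in_upper_half_plane:
  "A \<in> carrier SL2Z \<Longrightarrow> \<tau> \<in> upper_half_plane \<Longrightarrow> moebius A \<tau> \<in> upper_half_plane"
  unfolding moebius_def automorphy_factor_def upper_half_plane_def
  using Im_fractional_linear(2)[OF det_SL2Z] by simp

lemma open_upper_half_plane: "open upper_half_plane"
  unfolding upper_half_plane_def by (rule open_halfspace_Im_gt)

lemma moebius_has_field_derivative: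
  assumes "A \<in> carrier SL2Z" "\<tau> \<in> upper_half_plane"
  shows "(moebius A has_field_derivative 1 / (automorphy_factor A \<tau>)\<^sup>2) (at \<tau>)"
proof -
  let ?J = "of_int (A$2$1) * \<tau> + of_int (A$2$2)"
  have J: "?J \<noteq> 0" using automorphy_factor_nonzero[OF assms] by (simp add: automorphy_factor_def)
  have "(moebius A has_field_derivative
          (of_int (A$1$1) * ?J - (of_int (A$1$1) * \<tau> + of_int (A$1$2)) * of_int (A$2$1)) / (?J * ?J)) (at \<tau>)"
    unfolding moebius_def[abs_def] automorphy_factor_def using J
    by (auto intro!: derivative_eq_intros)
  moreover have "of_int a * (of_int c * \<tau> + of_int d) - (of_int a * \<tau> + of_int b) * of_int c = of_int (a * d - b * c)"
    for a b c d :: int by (simp add: algebra_simps)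
  ultimately show ?thesis
    unfolding automorphy_factor_def power2_eq_square by (simp only: det_SL2Z[OF assms(1)] of_int_1)
qed

text \<open>
  The multiple \<open>\<pi> i / 6\<close> is the one for which the anomaly is exactly the cocycle.
\<close>

lemma E2_moebius:
  assumes "A \<in> carrier SL2Z" "\<tau> \<in> upper_half_plane"
  shows "of_real pi * \<i> / 6 * E2 (moebius A \<tau>) =
           (automorphy_factor A \<tau>)\<^sup>2 * (of_real pi * \<i> / 6 * E2 \<tau> + cocycle A \<tau>)"
proof -
  let ?J = "automorphy_factor A \<tau>"
  have "Im \<tau> > 0" using assms by (simp add: upper_half_plane_def)
  then have "E2 (moebius A \<tau>) = ?J\<^sup>2 * E2 \<tau> - 6 * \<i> * of_int (A$2$1) * ?J / of_real pi"
    unfolding moebius_def automorphy_factor_def by (intro E2_fractional_linear det_SL2Z assms)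
  then show ?thesis
    unfolding cocycle_def using automorphy_factor_nonzero[OF assms]
    by (simp only:) (simp add: field_simps power2_eq_square)
qed

definition E2_fps :: "complex fps" where
  "E2_fps = Abs_fps (\<lambda>r. if r = 0 then 1 else - 24 * of_nat (sigma1 r))"

lemma E2_fps_sums:
  assumes "norm q < 1"
  shows "(\<lambda>r. fps_nth E2_fps r * q ^ r) sums (1 - 24 * (\<Sum>r. of_nat (sigma1 (Suc r)) * q ^ Suc r))"
proof -
  have "(\<lambda>r. of_nat (sigma1 (Suc r)) * q ^ Suc r) sums (\<Sum>r. of_nat (sigma1 (Suc r)) * q ^ Suc r)"
    using has_sum_imp_sums[OF Lambert_series[OF assms]] sums_summable summable_sums by blast
  from sums_mult[OF this, of "- 24"]
  have "(\<lambda>r. fps_nth E2_fps (Suc r) * q ^ Suc r) sums (- 24 * (\<Sum>r. of_nat (sigma1 (Suc r)) * q ^ Suc r))"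
    by (simp add: E2_fps_def mult.assoc)
  from sums_Suc[OF this] show ?thesis by (simp add: E2_fps_def)
qed

lemma E2_fps_conv_radius: "fps_conv_radius E2_fps \<ge> 1"
  unfolding fps_conv_radius_def
proof (rule conv_radius_geI_ex')
  fix r :: real assume "0 < r" "ereal r < 1"
  then have "norm (of_real r :: complex) < 1" by simp
  from E2_fps_sums[OF this] show "summable (\<lambda>n. fps_nth E2_fps n * of_real r ^ n)"
    by (rule sums_summable)
qed

lemma E2_eq_eval_fps:
  assumes "\<tau> \<in> upper_half_plane"
  shows "E2 \<tau> = eval_fps E2_fps (exp (2 * of_real pi * \<i> * \<tau>))"
proof -
  have "norm (exp (2 * of_real pi * \<i> * \<tau>)) < 1"
    using assms by (intro norm_nome_less_1) (simp add: upper_half_plane_def)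
  from E2_fps_sums[OF this] show ?thesis
    unfolding E2_eq_nome_series eval_fps_def by (simp add: sums_iff)
qed

lemma E2_holomorphic: "E2 holomorphic_on upper_half_plane"
proof -
  let ?q = "\<lambda>\<tau>. exp (2 * of_real pi * \<i> * \<tau>)"
  have "?q \<tau> \<in> eball 0 (fps_conv_radius E2_fps)" if "\<tau> \<in> upper_half_plane" for \<tau>
  proof -
    have "norm (?q \<tau>) < 1"
      using that by (intro norm_nome_less_1) (simp add: upper_half_plane_def)
    then have "ereal (norm (?q \<tau>)) < fps_conv_radius E2_fps"
      by (intro less_le_trans[OF _ E2_fps_conv_radius]) (simp add: one_ereal_def)
    then show ?thesis by (simp add: in_eball_iff)
  qed
  then have "(eval_fps E2_fps \<circ> ?q) holomorphic_on upper_half_plane"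
    by (intro holomorphic_on_compose_gen[of _ _ _ "eball 0 (fps_conv_radius E2_fps)"] holomorphic_on_eval_fps)
       (auto intro!: holomorphic_intros)
  then show ?thesis
    by (rule holomorphic_transform) (simp add: E2_eq_eval_fps)
qed

lemma E2_meromorphic_at_infinity: "meromorphic_at_infinity E2"
  unfolding meromorphic_at_infinity_def
proof (intro exI conjI ballI)
  have "0 < fps_conv_radius E2_fps"
    by (rule less_le_trans[OF _ E2_fps_conv_radius]) simp
  then show "eval_fps E2_fps meromorphic_on {0}"
    by (intro analytic_on_imp_meromorphic_on analytic_on_eval_fps) (auto simp: in_eball_iff zero_ereal_def)
qed (auto simp: E2_eq_eval_fps)

section \<open>Meromorphy at infinity\<close>

lemma exp_nome_power:
  assumes "v \<ge> 1"
  shows "exp (2 * of_real pi * \<i> * \<tau> / of_nat (w * v)) ^ v = exp (2 * of_real pi * \<i> * \<tau> / of_nat w)"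
  using assms by (simp add: exp_of_nat_mult[symmetric])

lemma meromorphic_on_0_power:
  fixes g :: "complex \<Rightarrow> complex"
  assumes "g meromorphic_on {0}" "v \<ge> 1"
  shows "(\<lambda>q. g (q ^ v)) meromorphic_on {0}"
  by (rule meromorphic_on_compose[OF assms(1)]) (use assms(2) in \<open>auto intro!: analytic_intros\<close>)

text \<open>
  The product of the two widths serves both functions, as \<open>q\<close> for the smaller width is a power of
  \<open>q\<close> for the larger one.
\<close>

lemma meromorphic_at_infinity_common_width:
  assumes "meromorphic_at_infinity f1" "meromorphic_at_infinity f2"
  obtains w g1 g2 where "w \<ge> 1" "g1 meromorphic_on {0}" "g2 meromorphic_on {0}"
    "\<And>\<tau>. \<tau> \<in> upper_half_plane \<Longrightarrow> f1 \<tau> = g1 (exp (2 * of_real pi * \<i> * \<tau> / of_nat w))"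
    "\<And>\<tau>. \<tau> \<in> upper_half_plane \<Longrightarrow> f2 \<tau> = g2 (exp (2 * of_real pi * \<i> * \<tau> / of_nat w))"
proof -
  from assms(1) obtain w1 g1 where 1: "w1 \<ge> 1" "g1 meromorphic_on {0}"
    "\<And>\<tau>. \<tau> \<in> upper_half_plane \<Longrightarrow> f1 \<tau> = g1 (exp (2 * of_real pi * \<i> * \<tau> / of_nat w1))"
    unfolding meromorphic_at_infinity_def by blast
  from assms(2) obtain w2 g2 where 2: "w2 \<ge> 1" "g2 meromorphic_on {0}"
    "\<And>\<tau>. \<tau> \<in> upper_half_plane \<Longrightarrow> f2 \<tau> = g2 (exp (2 * of_real pi * \<i> * \<tau> / of_nat w2))"
    unfolding meromorphic_at_infinity_def by blast
  show ?thesis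
  proof (rule that[of "w1 * w2" "\<lambda>q. g1 (q ^ w2)" "\<lambda>q. g2 (q ^ w1)"])
    show "w1 * w2 \<ge> 1" using 1 2 by simp
    fix \<tau> assume \<tau>: "\<tau> \<in> upper_half_plane"
    show "f1 \<tau> = g1 (exp (2 * of_real pi * \<i> * \<tau> / of_nat (w1 * w2)) ^ w2)"
      unfolding exp_nome_power[OF 2(1)] by (rule 1(3)[OF \<tau>])
    show "f2 \<tau> = g2 (exp (2 * of_real pi * \<i> * \<tau> / of_nat (w1 * w2)) ^ w1)"
      unfolding mult.commute[of w1 w2] exp_nome_power[OF 1(1)] by (rule 2(3)[OF \<tau>])
  qed (intro meromorphic_on_0_power 1 2)+
qed

lemma meromorphic_at_infinity_const: "meromorphic_at_infinity (\<lambda>_. c)"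
  unfolding meromorphic_at_infinity_def
  by (intro exI[of _ "1::nat"] exI[of _ "\<lambda>_. c"]) auto

lemma meromorphic_at_infinity_add:
  assumes "meromorphic_at_infinity f1" "meromorphic_at_infinity f2"
  shows "meromorphic_at_infinity (\<lambda>\<tau>. f1 \<tau> + f2 \<tau>)"
proof -
  obtain w g1 g2 where w: "w \<ge> 1" "g1 meromorphic_on {0}" "g2 meromorphic_on {0}"
    "\<And>\<tau>. \<tau> \<in> upper_half_plane \<Longrightarrow> f1 \<tau> = g1 (exp (2 * of_real pi * \<i> * \<tau> / of_nat w))"
    "\<And>\<tau>. \<tau> \<in> upper_half_plane \<Longrightarrow> f2 \<tau> = g2 (exp (2 * of_real pi * \<i> * \<tau> / of_nat w))"
    using meromorphic_at_infinity_common_width[OF assms] by blast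
  then show ?thesis
    unfolding meromorphic_at_infinity_def
    by (intro exI[of _ w] exI[of _ "\<lambda>q. g1 q + g2 q"]) (auto intro: meromorphic_on_add)
qed

lemma meromorphic_at_infinity_mult:
  assumes "meromorphic_at_infinity f1" "meromorphic_at_infinity f2"
  shows "meromorphic_at_infinity (\<lambda>\<tau>. f1 \<tau> * f2 \<tau>)"
proof -
  obtain w g1 g2 where w: "w \<ge> 1" "g1 meromorphic_on {0}" "g2 meromorphic_on {0}"
    "\<And>\<tau>. \<tau> \<in> upper_half_plane \<Longrightarrow> f1 \<tau> = g1 (exp (2 * of_real pi * \<i> * \<tau> / of_nat w))"
    "\<And>\<tau>. \<tau> \<in> upper_half_plane \<Longrightarrow> f2 \<tau> = g2 (exp (2 * of_real pi * \<i> * \<tau> / of_nat w))"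
    using meromorphic_at_infinity_common_width[OF assms] by blast
  then show ?thesis
    unfolding meromorphic_at_infinity_def
    by (intro exI[of _ w] exI[of _ "\<lambda>q. g1 q * g2 q"]) (auto intro: meromorphic_on_mult)
qed

lemma meromorphic_at_infinity_sum:
  assumes "\<And>i. i \<in> I \<Longrightarrow> meromorphic_at_infinity (f i)"
  shows "meromorphic_at_infinity (\<lambda>\<tau>. \<Sum>i\<in>I. f i \<tau>)"
  using assms
  by (induction I rule: infinite_finite_induct)
     (auto intro: meromorphic_at_infinity_add meromorphic_at_infinity_const)

lemma meromorphic_at_infinity_cong:
  assumes "\<And>\<tau>. \<tau> \<in> upper_half_plane \<Longrightarrow> f \<tau> = f' \<tau>"
  shows "meromorphic_at_infinity f \<longleftrightarrow> meromorphic_at_infinity f'"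
  using assms by (simp add: meromorphic_at_infinity_def)

text \<open>
  If \<open>f(\<tau>) = g(q)\<close> with \<open>q = exp (c \<tau>)\<close> then \<open>f' = c q g'(q)\<close>. Meromorphy of \<open>g\<close> at 0
  says nothing about points away from 0, so the differentiability of \<open>g\<close> at \<open>q\<close> has to be
  recovered from that of \<open>f\<close> through a local branch \<open>L\<close> of the logarithm.
\<close>

lemma meromorphic_at_infinity_deriv:
  assumes "meromorphic_at_infinity f" "f holomorphic_on upper_half_plane"
  shows "meromorphic_at_infinity (deriv f)"
proof -
  from assms(1) obtain w g where w: "w \<ge> 1" and g: "g meromorphic_on {0}" and
    f: "\<And>\<tau>. \<tau> \<in> upper_half_plane \<Longrightarrow> f \<tau> = g (exp (2 * of_real pi * \<i> * \<tau> / of_nat w))"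
    unfolding meromorphic_at_infinity_def by blast
  define c where "c = 2 * of_real pi * \<i> / of_nat w"
  have c: "c \<noteq> 0" using w by (simp add: c_def)
  have f': "f \<tau> = g (exp (c * \<tau>))" if "\<tau> \<in> upper_half_plane" for \<tau>
    using f[OF that] by (simp add: c_def)
  have "deriv f \<tau> = c * exp (c * \<tau>) * deriv g (exp (c * \<tau>))" if \<tau>: "\<tau> \<in> upper_half_plane" for \<tau>
  proof -
    define q where "q = exp (c * \<tau>)"
    have q: "q \<noteq> 0" by (simp add: q_def)
    \<comment> \<open>The branch of the inverse of \<open>exp (c \<tau>)\<close> that sends \<open>q\<close> back to \<open>\<tau>\<close>.\<close>
    define L where "L = (\<lambda>x. \<tau> + Ln (x / q) / c)"
    have L_q: "L q = \<tau>" using q by (simp add: L_def)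
    have dL: "(L has_field_derivative 1 / (c * q)) (at q)"
      unfolding L_def using q c by (auto intro!: derivative_eq_intros simp: field_simps)
    have "isCont L q" using dL by (rule DERIV_isCont)
    then have "L \<midarrow>q\<rightarrow> \<tau>" unfolding isCont_def L_q .
    then have "\<forall>\<^sub>F x in at q. L x \<in> upper_half_plane"
      using open_upper_half_plane \<tau> by (rule topological_tendstoD)
    then have ev1: "\<forall>\<^sub>F x in nhds q. L x \<in> upper_half_plane"
      using \<tau> L_q by (simp add: eventually_nhds_conv_at)
    have ev2: "\<forall>\<^sub>F x in nhds q. x \<noteq> 0"
      using q by (rule t1_space_nhds)
    have eq: "\<forall>\<^sub>F x in nhds q. g x = f (L x)"
      using ev1 ev2
    proof eventually_elim
      case (elim x)
      have "c * L x = c * \<tau> + Ln (x / q)" using c by (simp add: L_def distrib_left)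
      then have "exp (c * L x) = x" using elim q by (simp add: exp_add q_def)
      then show ?case using f'[OF elim(1)] by simp
    qed
    have "(f has_field_derivative deriv f \<tau>) (at (L q))"
      unfolding L_q using assms(2) open_upper_half_plane \<tau> by (rule holomorphic_derivI)
    then have "((\<lambda>x. f (L x)) has_field_derivative deriv f \<tau> * (1 / (c * q))) (at q)"
      using dL by (rule DERIV_chain2)
    then have "(g has_field_derivative deriv f \<tau> * (1 / (c * q))) (at q)"
      using DERIV_cong_ev[OF refl eq refl] by simp
    then have "deriv g q = deriv f \<tau> * (1 / (c * q))" by (rule DERIV_imp_deriv)
    then show ?thesis using c q by (simp add: q_def[symmetric])
  qed
  moreover have "(\<lambda>q. c * q * deriv g q) meromorphic_on {0}"
    by (intro meromorphic_intros g)
  ultimately show ?thesis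
    unfolding meromorphic_at_infinity_def using w
    by (intro exI[of _ w] exI[of _ "\<lambda>q. c * q * deriv g q"]) (auto simp: c_def)
qed

lemma meromorphic_at_infinity_higher_deriv:
  assumes "meromorphic_at_infinity f" "f holomorphic_on upper_half_plane"
  shows "meromorphic_at_infinity ((deriv ^^ m) f)"
proof (induction m)
  case (Suc m)
  then show ?case
    using meromorphic_at_infinity_deriv holomorphic_higher_deriv[OF assms(2) open_upper_half_plane] by simp
qed (use assms in simp)

section \<open>Multiplication by an exponential series\<close>

text \<open>
  Coefficient of \<open>X^m\<close> in \<open>exp (K X) \<Sum> a\<^sub>i X^i\<close>, written as a sum so that it can be differentiated
  both in \<open>K\<close> and in the parameters of \<open>a\<close>.
\<close>

definition exp_twist :: "complex \<Rightarrow> (nat \<Rightarrow> complex) \<Rightarrow> nat \<Rightarrow> complex" where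
  "exp_twist K a m = (\<Sum>i\<le>m. K ^ i / fact i * a (m - i))"

lemma exp_twist_eq_fps_nth: "exp_twist K a m = fps_nth (fps_exp K * Abs_fps a) m"
  by (simp add: exp_twist_def fps_mult_nth atLeast0AtMost)

lemma exp_twist_0 [simp]: "exp_twist K a 0 = a 0"
  by (simp add: exp_twist_def)

lemma exp_twist_at_0 [simp]: "exp_twist 0 a m = a m"
proof -
  have "exp_twist 0 a m = (\<Sum>i\<le>m. if i = 0 then a m else 0)"
    unfolding exp_twist_def by (rule sum.cong) (auto simp: power_0_left)
  then show ?thesis by simp
qed

lemma exp_twist_has_field_derivative:
  "((\<lambda>K. exp_twist K a (Suc m)) has_field_derivative exp_twist K a m) (at K)"
proof -
  have "exp_twist K a (Suc m) = a (Suc m) + (\<Sum>i\<le>m. K ^ Suc i / fact (Suc i) * a (m - i))" for K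
    by (simp only: exp_twist_def sum.atMost_Suc_shift) simp
  moreover have "((\<lambda>K. K ^ Suc i / fact (Suc i) * a (m - i)) has_field_derivative K ^ i / fact i * a (m - i)) (at K)" for i
  proof -
    have "((\<lambda>K. K ^ Suc i / fact (Suc i) * a (m - i)) has_field_derivative
            of_nat (Suc i) * K ^ i / fact (Suc i) * a (m - i)) (at K)"
      by (intro DERIV_cmult_right DERIV_cdivide, rule DERIV_cong[OF DERIV_power_Suc[OF DERIV_ident]]) simp
    also have "of_nat (Suc i) * K ^ i / fact (Suc i) = K ^ i / (fact i :: complex)"
      by (simp del: of_nat_Suc)
    finally show ?thesis .
  qed
  then have "((\<lambda>K. a (Suc m) + (\<Sum>i\<le>m. K ^ Suc i / fact (Suc i) * a (m - i))) has_field_derivative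
      0 + (\<Sum>i\<le>m. K ^ i / fact i * a (m - i))) (at K)"
    by (intro DERIV_add DERIV_sum DERIV_const)
  ultimately show ?thesis by (simp add: exp_twist_def)
qed

text \<open>
  A sequence of functions in which each member is the derivative of the next, starting with a
  constant, is determined by its values at 0. This replaces a direct comparison of double sums in
  \<open>tail_form_exp_twist\<close>.
\<close>

lemma exp_twist_unique:
  fixes x :: "nat \<Rightarrow> complex \<Rightarrow> complex"
  assumes "\<And>K. (x 0 has_field_derivative 0) (at K)"
    and "\<And>i K. (x (Suc i) has_field_derivative x i K) (at K)"
  shows "x m K = exp_twist K (\<lambda>i. x i 0) m"
proof (induction m arbitrary: K)
  case 0
  obtain c where "\<And>K. x 0 K = c"
    using has_field_derivative_zero_constant[of UNIV "x 0"] assms(1) by auto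
  then show ?case by simp
next
  case (Suc m)
  have "((\<lambda>K. x (Suc m) K - exp_twist K (\<lambda>i. x i 0) (Suc m)) has_field_derivative 0) (at K)" for K
    using DERIV_diff[OF assms(2)[of m K] exp_twist_has_field_derivative[of "\<lambda>i. x i 0" m K]] Suc by simp
  then obtain c where c: "\<And>K. x (Suc m) K - exp_twist K (\<lambda>i. x i 0) (Suc m) = c"
    using has_field_derivative_zero_constant[of UNIV "\<lambda>K. x (Suc m) K - exp_twist K (\<lambda>i. x i 0) (Suc m)"] by auto
  from c[of 0] c[of K] show ?case by simp
qed

text \<open>
  The algebra behind differentiating the functional equation: the left side is the derivative of
  \<open>J^(k+2m) exp_twist K a m\<close> divided by \<open>J^(k+2m)\<close>, given that \<open>J' = K J\<close>, \<open>K' = -K\<^sup>2\<close> and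
  \<open>a\<^sub>i' = (i + 1)(i + k) a\<^bsub>i+1\<^esub>\<close>. Comparing coefficients of \<open>K^i / i! a\<^bsub>m+1-i\<^esub>\<close>, it amounts to
  \<open>i (k + 2m - i + 1) + (m - i + 1)(m - i + k) = (m + 1)(m + k)\<close>.
\<close>

lemma exp_twist_raising:
  fixes K k :: complex and a :: "nat \<Rightarrow> complex"
  shows "(\<Sum>i\<le>m. (k + 2 * of_nat m - of_nat i) * K ^ Suc i / fact i * a (m - i)) +
         (\<Sum>i\<le>m. K ^ i / fact i * ((of_nat (m - i) + 1) * (of_nat (m - i) + k) * a (Suc (m - i)))) =
         (of_nat m + 1) * (of_nat m + k) * exp_twist K a (Suc m)"
proof -
  let ?c1 = "\<lambda>i. of_nat i * (k + 2 * of_nat m - of_nat i + 1) :: complex"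
  let ?c2 = "\<lambda>i. (of_nat m - of_nat i + 1) * (of_nat m - of_nat i + k) :: complex"
  let ?t = "\<lambda>i. K ^ i / fact i * a (Suc m - i)"
  have "(\<Sum>i\<le>m. (k + 2 * of_nat m - of_nat i) * K ^ Suc i / fact i * a (m - i)) = (\<Sum>i\<le>m. ?c1 (Suc i) * ?t (Suc i))"
  proof (rule sum.cong)
    fix i
    have step: "x / fact i = of_nat (Suc i) * x / (fact (Suc i) :: complex)" for x
      by (simp del: of_nat_Suc)
    have shift: "k + 2 * of_nat m - of_nat (Suc i) + 1 = k + 2 * of_nat m - of_nat i" by simp
    show "(k + 2 * of_nat m - of_nat i) * K ^ Suc i / fact i * a (m - i) = ?c1 (Suc i) * ?t (Suc i)"
      unfolding shift diff_Suc_Suc step by (simp only: mult_ac times_divide_eq_left times_divide_eq_right)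
  qed simp
  also have "\<dots> = (\<Sum>i\<le>Suc m. ?c1 i * ?t i)"
    by (simp only: sum.atMost_Suc_shift) simp
  finally have 1: "(\<Sum>i\<le>m. (k + 2 * of_nat m - of_nat i) * K ^ Suc i / fact i * a (m - i)) = (\<Sum>i\<le>Suc m. ?c1 i * ?t i)" .
  have "(\<Sum>i\<le>m. K ^ i / fact i * ((of_nat (m - i) + 1) * (of_nat (m - i) + k) * a (Suc (m - i)))) = (\<Sum>i\<le>m. ?c2 i * ?t i)"
    by (rule sum.cong) (auto simp: of_nat_diff Suc_diff_le)
  also have "\<dots> = (\<Sum>i\<le>Suc m. ?c2 i * ?t i)"
    by simp
  finally have 2: "(\<Sum>i\<le>m. K ^ i / fact i * ((of_nat (m - i) + 1) * (of_nat (m - i) + k) * a (Suc (m - i)))) = (\<Sum>i\<le>Suc m. ?c2 i * ?t i)" .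
  have "?c1 i + ?c2 i = (of_nat m + 1) * (of_nat m + k)" for i
    by (simp add: algebra_simps)
  then have "(\<Sum>i\<le>Suc m. ?c1 i * ?t i) + (\<Sum>i\<le>Suc m. ?c2 i * ?t i) = (\<Sum>i\<le>Suc m. (of_nat m + 1) * (of_nat m + k) * ?t i)"
    by (simp only: sum.distrib[symmetric] distrib_right[symmetric])
  then show ?thesis unfolding 1 2 exp_twist_def sum_distrib_left .
qed

section \<open>Propagating the functional equation by differentiation\<close>

lemma automorphy_factor_powi_has_field_derivative:
  assumes "A \<in> carrier SL2Z" "\<tau> \<in> upper_half_plane"
  shows "((\<lambda>\<tau>. automorphy_factor A \<tau> powi N) has_field_derivative
           of_int N * cocycle A \<tau> * automorphy_factor A \<tau> powi N) (at \<tau>)"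
proof -
  note J = automorphy_factor_nonzero[OF assms]
  have "(automorphy_factor A has_field_derivative of_int (A$2$1)) (at \<tau>)"
    unfolding automorphy_factor_def[abs_def] by (auto intro!: derivative_eq_intros)
  from DERIV_power_int[OF this disjI2[OF J], of N]
  have "((\<lambda>\<tau>. automorphy_factor A \<tau> powi N) has_field_derivative
      of_int N * automorphy_factor A \<tau> powi (N - 1) * of_int (A$2$1)) (at \<tau>)" .
  moreover have "automorphy_factor A \<tau> powi (N - 1) * of_int (A$2$1) = cocycle A \<tau> * automorphy_factor A \<tau> powi N"
    using J by (simp add: cocycle_def power_int_diff)
  ultimately show ?thesis by (simp add: mult.assoc)
qed

lemma cocycle_has_field_derivative:
  assumes "A \<in> carrier SL2Z" "\<tau> \<in> upper_half_plane"
  shows "(cocycle A has_field_derivative - (cocycle A \<tau>)\<^sup>2) (at \<tau>)"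
proof -
  note J = automorphy_factor_nonzero[OF assms]
  have "(automorphy_factor A has_field_derivative of_int (A$2$1)) (at \<tau>)"
    unfolding automorphy_factor_def[abs_def] by (auto intro!: derivative_eq_intros)
  then show ?thesis
    unfolding cocycle_def[abs_def] using J
    by (auto intro!: derivative_eq_intros simp: power2_eq_square)
qed

text \<open>
  Both sides of the equation for \<open>m\<close> are differentiated. The left side gains the factor \<open>1 / J\<^sup>2\<close>
  from the action, and \<open>(m + 1)(m + k)\<close> can be cancelled because it is nonzero.
\<close>

lemma exp_twist_transformation_step:
  fixes \<phi> \<psi> :: "nat \<Rightarrow> complex \<Rightarrow> complex" and k :: int
  assumes A: "A \<in> carrier SL2Z"
    and \<phi>: "\<And>\<tau>. \<tau> \<in> upper_half_plane \<Longrightarrow>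
      (\<phi> m has_field_derivative (of_nat m + 1) * (of_nat m + of_int k) * \<phi> (Suc m) \<tau>) (at \<tau>)"
    and \<psi>: "\<And>i \<tau>. i \<le> m \<Longrightarrow> \<tau> \<in> upper_half_plane \<Longrightarrow>
      (\<psi> i has_field_derivative (of_nat i + 1) * (of_nat i + of_int k) * \<psi> (Suc i) \<tau>) (at \<tau>)"
    and nz: "int m + k \<noteq> 0"
    and IH: "\<And>\<tau>. \<tau> \<in> upper_half_plane \<Longrightarrow>
      \<phi> m (moebius A \<tau>) = automorphy_factor A \<tau> powi (k + 2 * int m) * exp_twist (cocycle A \<tau>) (\<lambda>i. \<psi> i \<tau>) m"
    and \<tau>: "\<tau> \<in> upper_half_plane"
  shows "\<phi> (Suc m) (moebius A \<tau>) =
    automorphy_factor A \<tau> powi (k + 2 * int (Suc m)) * exp_twist (cocycle A \<tau>) (\<lambda>i. \<psi> i \<tau>) (Suc m)"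
proof -
  let ?J = "automorphy_factor A \<tau>" and ?K = "cocycle A \<tau>" and ?N = "k + 2 * int m"
  define C :: complex where "C = (of_nat m + 1) * (of_nat m + of_int k)"
  have "of_nat m + of_int k = (of_int (int m + k) :: complex)" by simp
  then have C: "C \<noteq> 0" unfolding C_def using nz of_int_eq_0_iff[where ?'a = complex]
    by (metis mult_eq_0_iff of_nat_Suc of_nat_neq_0 add.commute)
  note J = automorphy_factor_nonzero[OF A \<tau>]
  define X' where "X' = (\<Sum>i\<le>m. (- of_nat i * ?K ^ Suc i) / fact i * \<psi> (m - i) \<tau> +
      ?K ^ i / fact i * ((of_nat (m - i) + 1) * (of_nat (m - i) + of_int k) * \<psi> (Suc (m - i)) \<tau>))"
  have summand: "((\<lambda>\<tau>. cocycle A \<tau> ^ i / fact i * \<psi> (m - i) \<tau>) has_field_derivative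
      ((- of_nat i * ?K ^ Suc i) / fact i * \<psi> (m - i) \<tau> +
      ?K ^ i / fact i * ((of_nat (m - i) + 1) * (of_nat (m - i) + of_int k) * \<psi> (Suc (m - i)) \<tau>))) (at \<tau>)" for i
  proof -
    have "((\<lambda>\<tau>. cocycle A \<tau> ^ i) has_field_derivative of_nat i * (- ?K\<^sup>2 * ?K ^ (i - Suc 0))) (at \<tau>)"
      by (rule DERIV_power[OF cocycle_has_field_derivative[OF A \<tau>]])
    also have "of_nat i * (- ?K\<^sup>2 * ?K ^ (i - Suc 0)) = - of_nat i * ?K ^ Suc i"
      by (cases i) (simp_all add: power2_eq_square algebra_simps)
    finally have "((\<lambda>\<tau>. cocycle A \<tau> ^ i / fact i) has_field_derivative (- of_nat i * ?K ^ Suc i) / fact i) (at \<tau>)"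
      by (rule DERIV_cdivide)
    from DERIV_mult'[OF this \<psi>[of "m - i" \<tau>]] \<tau> show ?thesis by (simp add: add.commute)
  qed
  have "((\<lambda>\<tau>. exp_twist (cocycle A \<tau>) (\<lambda>i. \<psi> i \<tau>) m) has_field_derivative X') (at \<tau>)"
    unfolding exp_twist_def X'_def by (intro DERIV_sum summand)
  from DERIV_mult'[OF automorphy_factor_powi_has_field_derivative[OF A \<tau>, of ?N] this]
  have rhs: "((\<lambda>\<tau>. automorphy_factor A \<tau> powi ?N * exp_twist (cocycle A \<tau>) (\<lambda>i. \<psi> i \<tau>) m) has_field_derivative
      ?J powi ?N * X' + of_int ?N * ?K * ?J powi ?N * exp_twist ?K (\<lambda>i. \<psi> i \<tau>) m) (at \<tau>)" .
  have "((\<lambda>\<tau>. \<phi> m (moebius A \<tau>)) has_field_derivative C * \<phi> (Suc m) (moebius A \<tau>) * (1 / ?J\<^sup>2)) (at \<tau>)"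
    unfolding C_def
    by (rule DERIV_chain2[OF \<phi>[OF moebius_in_upper_half_plane[OF A \<tau>]] moebius_has_field_derivative[OF A \<tau>]])
  then have "((\<lambda>\<tau>. automorphy_factor A \<tau> powi ?N * exp_twist (cocycle A \<tau>) (\<lambda>i. \<psi> i \<tau>) m) has_field_derivative
      C * \<phi> (Suc m) (moebius A \<tau>) * (1 / ?J\<^sup>2)) (at \<tau>)"
    by (rule has_field_derivative_transform_within_open[OF _ open_upper_half_plane \<tau>]) (rule IH)
  then have "C * \<phi> (Suc m) (moebius A \<tau>) * (1 / ?J\<^sup>2) =
      ?J powi ?N * X' + of_int ?N * ?K * ?J powi ?N * exp_twist ?K (\<lambda>i. \<psi> i \<tau>) m"
    using rhs by (rule DERIV_unique)
  also have "\<dots> = ?J powi ?N * (of_int ?N * ?K * exp_twist ?K (\<lambda>i. \<psi> i \<tau>) m + X')"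
    by (simp add: algebra_simps)
  also have "of_int ?N * ?K * exp_twist ?K (\<lambda>i. \<psi> i \<tau>) m + X' = C * exp_twist ?K (\<lambda>i. \<psi> i \<tau>) (Suc m)"
  proof -
    have "of_int ?N * ?K * exp_twist ?K (\<lambda>i. \<psi> i \<tau>) m + X' =
       (\<Sum>i\<le>m. (of_int k + 2 * of_nat m - of_nat i) * ?K ^ Suc i / fact i * \<psi> (m - i) \<tau>) +
       (\<Sum>i\<le>m. ?K ^ i / fact i * ((of_nat (m - i) + 1) * (of_nat (m - i) + of_int k) * \<psi> (Suc (m - i)) \<tau>))"
      unfolding exp_twist_def X'_def sum_distrib_left sum.distrib[symmetric]
    proof (rule sum.cong)
      fix i
      have "of_int ?N * ?K * (?K ^ i / fact i * \<psi> (m - i) \<tau>) + (- of_nat i * ?K ^ Suc i) / fact i * \<psi> (m - i) \<tau> =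
          (of_int k + 2 * of_nat m - of_nat i) * ?K ^ Suc i / fact i * \<psi> (m - i) \<tau>"
        by (simp add: add_divide_distrib diff_divide_distrib algebra_simps)
      then show "of_int ?N * ?K * (?K ^ i / fact i * \<psi> (m - i) \<tau>) +
         ((- of_nat i * ?K ^ Suc i) / fact i * \<psi> (m - i) \<tau> +
          ?K ^ i / fact i * ((of_nat (m - i) + 1) * (of_nat (m - i) + of_int k) * \<psi> (Suc (m - i)) \<tau>)) =
         (of_int k + 2 * of_nat m - of_nat i) * ?K ^ Suc i / fact i * \<psi> (m - i) \<tau> +
         ?K ^ i / fact i * ((of_nat (m - i) + 1) * (of_nat (m - i) + of_int k) * \<psi> (Suc (m - i)) \<tau>)"
        by (simp only: add.assoc[symmetric])
    qed simp
    then show ?thesis unfolding C_def exp_twist_raising[where a = "\<lambda>i. \<psi> i \<tau>"] .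
  qed
  finally have "\<phi> (Suc m) (moebius A \<tau>) = ?J powi ?N * ?J\<^sup>2 * exp_twist ?K (\<lambda>i. \<psi> i \<tau>) (Suc m)"
    using C J by (simp add: field_simps)
  also have "?J powi ?N * ?J\<^sup>2 = ?J powi (k + 2 * int (Suc m))"
  proof -
    have "?J powi (k + 2 * int (Suc m)) = ?J powi (?N + 2)" by (simp add: algebra_simps)
    also have "\<dots> = ?J powi ?N * ?J powi 2" using J by (simp add: power_int_add)
    finally show ?thesis by simp
  qed
  finally show ?thesis .
qed

text \<open>
  Coefficients of a series of weight 0 with constant term 1. As for \<^const>\<open>lift_series\<close> in weight
  0, differentiation gives no information in degree 0, where the factor \<open>m (m + 1)\<close> vanishes; the
  transformation law of \<open>E\<^sub>2\<close> takes the place of this step.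
\<close>

definition E2_lift :: "nat \<Rightarrow> complex \<Rightarrow> complex" where
  "E2_lift m \<tau> = (case m of 0 \<Rightarrow> 1 | Suc p \<Rightarrow> of_real pi * \<i> / 6 * (deriv ^^ p) E2 \<tau> / (fact p * fact (Suc p)))"

lemma higher_deriv_has_field_derivative:
  assumes "f holomorphic_on upper_half_plane" "\<tau> \<in> upper_half_plane"
  shows "((deriv ^^ m) f has_field_derivative (deriv ^^ Suc m) f \<tau>) (at \<tau>)"
  using holomorphic_derivI[OF holomorphic_higher_deriv[OF assms(1) open_upper_half_plane] open_upper_half_plane assms(2)]
  by simp

lemma E2_lift_has_field_derivative:
  assumes "\<tau> \<in> upper_half_plane"
  shows "(E2_lift m has_field_derivative (of_nat m + 1) * (of_nat m + of_int 0) * E2_lift (Suc m) \<tau>) (at \<tau>)"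
proof (cases m)
  case 0
  then show ?thesis by (simp add: E2_lift_def[abs_def])
next
  case (Suc p)
  have "((\<lambda>\<tau>. of_real pi * \<i> / 6 * (deriv ^^ p) E2 \<tau> / (fact p * fact (Suc p))) has_field_derivative
      of_real pi * \<i> / 6 * (deriv ^^ Suc p) E2 \<tau> / (fact p * fact (Suc p))) (at \<tau>)"
    by (intro DERIV_cdivide DERIV_cmult higher_deriv_has_field_derivative E2_holomorphic assms)
  also have "of_real pi * \<i> / 6 * (deriv ^^ Suc p) E2 \<tau> / (fact p * fact (Suc p)) =
      (of_nat m + 1) * (of_nat m + of_int 0) * E2_lift (Suc m) \<tau>"
  proof -
    have "x / (fact p * fact (Suc p)) = (of_nat m + 1) * (of_nat m + of_int 0) * (x / (fact m * fact (Suc m) :: complex))" for x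
    proof -
      have "(fact m * fact (Suc m) :: complex) = (of_nat m * (of_nat m + 1)) * (fact p * fact (Suc p))"
        unfolding Suc by (simp add: algebra_simps)
      moreover have "of_nat m * (of_nat m + 1) \<noteq> (0 :: complex)"
        unfolding Suc by (metis mult_eq_0_iff of_nat_Suc of_nat_neq_0 add.commute)
      ultimately show ?thesis by (simp add: mult.commute)
    qed
    then show ?thesis by (simp only: E2_lift_def nat.case Suc)
  qed
  finally show ?thesis by (simp add: E2_lift_def[abs_def] Suc)
qed

lemma E2_lift_moebius:
  assumes A: "A \<in> carrier SL2Z" and "\<tau> \<in> upper_half_plane"
  shows "E2_lift m (moebius A \<tau>) =
    automorphy_factor A \<tau> powi (2 * int m) * exp_twist (cocycle A \<tau>) (\<lambda>i. E2_lift i \<tau>) m"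
proof -
  have "E2_lift (Suc m) (moebius A \<tau>) =
    automorphy_factor A \<tau> powi (0 + 2 * int (Suc m)) * exp_twist (cocycle A \<tau>) (\<lambda>i. E2_lift i \<tau>) (Suc m)"
    if "\<tau> \<in> upper_half_plane" for m \<tau>
    using that
  proof (induction m arbitrary: \<tau>)
    case 0
    have "E2_lift (Suc 0) (moebius A \<tau>) = of_real pi * \<i> / 6 * E2 (moebius A \<tau>)"
      by (simp add: E2_lift_def)
    also have "\<dots> = (automorphy_factor A \<tau>)\<^sup>2 * (of_real pi * \<i> / 6 * E2 \<tau> + cocycle A \<tau>)"
      by (rule E2_moebius[OF A 0])
    finally show ?case by (simp add: exp_twist_def E2_lift_def add.commute)
  next
    case (Suc m)
    show ?case
      by (rule exp_twist_transformation_step[where \<phi> = E2_lift and \<psi> = E2_lift and k = 0, OF A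
            E2_lift_has_field_derivative E2_lift_has_field_derivative _ Suc.IH Suc.prems]) auto
  qed
  note * = this
  show ?thesis
  proof (cases m)
    case 0
    then show ?thesis by (simp add: E2_lift_def)
  next
    case (Suc p)
    then show ?thesis using *[OF assms(2), of p] by simp
  qed
qed

section \<open>The coefficients beyond the derivatives\<close>

text \<open>
  With \<open>M = -2n\<close> this is the shape of the coefficient of index \<open>M + p + 1\<close> of the lift, in terms of the
  first \<open>M + 1\<close> coefficients \<open>u\<close> of the lift and the coefficients \<open>v\<close> of the weight-0 series of \<open>E\<^sub>2\<close>.
\<close>

definition tail_form :: "nat \<Rightarrow> (nat \<Rightarrow> complex) \<Rightarrow> (nat \<Rightarrow> complex) \<Rightarrow> nat \<Rightarrow> complex" where
  "tail_form M u v p = (\<Sum>j\<le>M. (-1) ^ j * of_nat ((M - j + p) choose p) * (u j * v (M + p + 1 - j)))"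

text \<open>
  Lowering every index of \<open>u\<close> and \<open>v\<close> in turn, as a derivation does, lowers the index of the bilinear
  form. After shifting the summation index in the \<open>u\<close>-part, neighbouring binomial coefficients are
  subtracted and Pascal's rule applies. For \<open>p = 0\<close> all binomial coefficients are 1 and only the
  boundary term \<open>u\<^sub>M v\<^sub>0\<close> is left, with sign \<open>(-1)^M = 1\<close>.
\<close>

lemma tail_form_lowering:
  assumes "even M" "v 0 = 1"
  shows "(\<Sum>j\<le>M. (-1) ^ j * of_nat ((M - j + p) choose p) *
            ((case j of 0 \<Rightarrow> 0 | Suc i \<Rightarrow> u i) * v (M + p + 1 - j) + u j * v (M + p - j))) =
         (case p of 0 \<Rightarrow> u M | Suc r \<Rightarrow> tail_form M u v r)"
proof -
  let ?B = "\<lambda>j. of_nat ((M - j + p) choose p) :: complex"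
  let ?w = "\<lambda>j. u j * v (M + p - j)"
  have "(\<Sum>j\<le>M. (-1) ^ j * ?B j * ((case j of 0 \<Rightarrow> 0 | Suc i \<Rightarrow> u i) * v (M + p + 1 - j) + u j * v (M + p - j))) =
      (\<Sum>j<Suc M. (-1) ^ j * ?B j * ((case j of 0 \<Rightarrow> 0 | Suc i \<Rightarrow> u i) * v (M + p + 1 - j))) +
      (\<Sum>j<Suc M. (-1) ^ j * ?B j * ?w j)"
    by (simp only: lessThan_Suc_atMost distrib_left sum.distrib)
  also have "(\<Sum>j<Suc M. (-1) ^ j * ?B j * ((case j of 0 \<Rightarrow> 0 | Suc i \<Rightarrow> u i) * v (M + p + 1 - j))) =
      (\<Sum>i<M. - ((-1) ^ i * ?B (Suc i) * ?w i))"
    unfolding sum.lessThan_Suc_shift by simp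
  also have "(\<Sum>j<Suc M. (-1) ^ j * ?B j * ?w j) = (\<Sum>i<M. (-1) ^ i * ?B i * ?w i) + u M * v p"
    using assms(1) by simp
  also have "(\<Sum>i<M. - ((-1) ^ i * ?B (Suc i) * ?w i)) + ((\<Sum>i<M. (-1) ^ i * ?B i * ?w i) + u M * v p) =
      (\<Sum>i<M. (-1) ^ i * (?B i - ?B (Suc i)) * ?w i) + u M * v p"
    by (simp add: sum.distrib[symmetric] algebra_simps sum_negf sum_subtractf)
  also have "\<dots> = (case p of 0 \<Rightarrow> u M | Suc r \<Rightarrow> tail_form M u v r)"
  proof (cases p)
    case 0
    then show ?thesis using assms(2) by simp
  next
    case (Suc r)
    have "?B i - ?B (Suc i) = of_nat ((M - i + r) choose r)" if "i < M" for i
    proof -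
      define t where "t = M - Suc i"
      have t: "M - i = Suc t" and t': "M - Suc i = t" using that by (simp_all add: t_def)
      show ?thesis unfolding t t' Suc by simp
    qed
    then have "(\<Sum>i<M. (-1) ^ i * (?B i - ?B (Suc i)) * ?w i) =
        (\<Sum>i<M. (-1) ^ i * of_nat ((M - i + r) choose r) * (u i * v (M + r + 1 - i)))"
      by (intro sum.cong) (auto simp: Suc)
    moreover have "tail_form M u v r =
        (\<Sum>i<M. (-1) ^ i * of_nat ((M - i + r) choose r) * (u i * v (M + r + 1 - i))) + u M * v p"
      unfolding tail_form_def lessThan_Suc_atMost[symmetric] using assms(1) by (simp add: Suc)
    ultimately show ?thesis by (simp add: Suc)
  qed
  finally show ?thesis .
qed

lemma exp_twist_has_field_derivative_case:
  "((\<lambda>K. exp_twist K a m) has_field_derivative (case m of 0 \<Rightarrow> 0 | Suc i \<Rightarrow> exp_twist K a i)) (at K)"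
  by (cases m) (simp_all add: exp_twist_has_field_derivative)

lemma tail_form_has_field_derivative:
  assumes "even M" "v 0 = 1"
  shows "((\<lambda>K. tail_form M (exp_twist K u) (exp_twist K v) p) has_field_derivative
     (case p of 0 \<Rightarrow> exp_twist K u M | Suc r \<Rightarrow> tail_form M (exp_twist K u) (exp_twist K v) r)) (at K)"
proof -
  have "((\<lambda>K. exp_twist K u j * exp_twist K v (M + p + 1 - j)) has_field_derivative
      (case j of 0 \<Rightarrow> 0 | Suc i \<Rightarrow> exp_twist K u i) * exp_twist K v (M + p + 1 - j) +
      exp_twist K u j * exp_twist K v (M + p - j)) (at K)" if "j \<le> M" for j
  proof -
    have "M + p + 1 - j = Suc (M + p - j)" using that by simp
    then have "((\<lambda>K. exp_twist K v (M + p + 1 - j)) has_field_derivative exp_twist K v (M + p - j)) (at K)"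
      by (simp only: exp_twist_has_field_derivative)
    from DERIV_mult'[OF exp_twist_has_field_derivative_case this] show ?thesis
      by (simp only: add.commute)
  qed
  then have "((\<lambda>K. tail_form M (exp_twist K u) (exp_twist K v) p) has_field_derivative
     (\<Sum>j\<le>M. (-1) ^ j * of_nat ((M - j + p) choose p) *
            ((case j of 0 \<Rightarrow> 0 | Suc i \<Rightarrow> exp_twist K u i) * exp_twist K v (M + p + 1 - j) +
             exp_twist K u j * exp_twist K v (M + p - j)))) (at K)"
    unfolding tail_form_def by (intro DERIV_sum DERIV_cmult) auto
  then show ?thesis
    using tail_form_lowering[OF assms(1), of "exp_twist K v" p "exp_twist K u"] assms(2) by simp
qed

text \<open>
  As functions of \<open>K\<close>, the twisted coefficients of index up to \<open>M\<close>, followed by the bilinear forms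
  of the twisted sequences, are successive antiderivatives, so \<open>exp_twist_unique\<close> identifies them.
\<close>

lemma tail_form_exp_twist:
  assumes "even M" "v 0 = 1"
  shows "tail_form M (exp_twist K u) (exp_twist K v) p =
     exp_twist K (\<lambda>i. if i \<le> M then u i else tail_form M u v (i - Suc M)) (Suc (M + p))"
proof -
  define x where "x = (\<lambda>i K. if i \<le> M then exp_twist K u i
     else tail_form M (exp_twist K u) (exp_twist K v) (i - Suc M))"
  have "x (Suc (M + p)) K = exp_twist K (\<lambda>i. x i 0) (Suc (M + p))"
  proof (rule exp_twist_unique)
    show "(x 0 has_field_derivative 0) (at K)" for K
      by (simp add: x_def)
    show "(x (Suc i) has_field_derivative x i K) (at K)" for i K
    proof (cases "Suc i \<le> M")
      case True
      then show ?thesis by (simp add: x_def exp_twist_has_field_derivative)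
    next
      case False
      have "x (Suc i) = (\<lambda>K. tail_form M (exp_twist K u) (exp_twist K v) (i - M))"
        using False by (simp add: x_def fun_eq_iff)
      moreover have "x i K = (case i - M of 0 \<Rightarrow> exp_twist K u M | Suc r \<Rightarrow> tail_form M (exp_twist K u) (exp_twist K v) r)"
      proof (cases "i = M")
        case True
        then show ?thesis by (simp add: x_def)
      next
        case neq: False
        then have "i - M = Suc (i - Suc M)" using False by simp
        then show ?thesis using neq False by (simp add: x_def)
      qed
      ultimately show ?thesis
        using tail_form_has_field_derivative[where M = M and v = v and u = u and p = "i - M" and K = K, OF assms] by simp
    qed
  qed
  moreover have "(\<lambda>i. x i 0) = (\<lambda>i. if i \<le> M then u i else tail_form M u v (i - Suc M))"
    by (simp add: x_def fun_eq_iff tail_form_def)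
  ultimately show ?thesis by (simp add: x_def)
qed

definition lift_term :: "int \<Rightarrow> (complex \<Rightarrow> complex) \<Rightarrow> nat \<Rightarrow> complex \<Rightarrow> complex" where
  "lift_term n f m \<tau> = lift_coeff n m * bracket_deriv n f m \<tau>"

lemma lift_term_derivative_range:
  assumes "n > 0 \<or> int m \<le> - 2 * n"
  shows "lift_term n f m = (\<lambda>\<tau>. lift_coeff n m * (deriv ^^ m) f \<tau>)"
  using assms by (auto simp: lift_term_def[abs_def] bracket_deriv_def)

lemma of_nat_plus_1_nonzero: "of_nat m + 1 \<noteq> (0 :: complex)"
  by (metis of_nat_Suc of_nat_neq_0 add.commute)

lemma expand_fraction: "c \<noteq> 0 \<Longrightarrow> x / D = c * (x / (c * D))" for c x D :: complex
  by simp

text \<open>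
  Both normalisations are versions of \<open>\<Gamma>(2n) / (m! \<Gamma>(m + 2n))\<close>, up to a constant factor. The
  range excludes precisely the step at which \<open>m + 2n\<close> vanishes.
\<close>

lemma lift_coeff_step:
  assumes "n > 0 \<or> int m < - 2 * n"
  shows "lift_coeff n m = (of_nat m + 1) * (of_nat m + of_int (2 * n)) * lift_coeff n (Suc m)"
proof (cases "n > 0")
  case True
  define t where "t = nat (int m + 2 * n - 1)"
  have t: "nat (int (Suc m) + 2 * n - 1) = Suc t" "nat (int m + 2 * n - 1) = t"
    "of_nat m + of_int (2 * n) = (of_nat (Suc t) :: complex)"
  proof -
    have "int (Suc t) = int m + 2 * n" using True by (simp add: t_def)
    then have "of_int (int (Suc t)) = (of_int (int m + 2 * n) :: complex)" by (rule arg_cong)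
    then show "of_nat m + of_int (2 * n) = (of_nat (Suc t) :: complex)"
      by (simp only: of_int_of_nat_eq of_int_add)
  qed (use True in \<open>auto simp: t_def\<close>)
  have "x / (fact m * fact t) = (of_nat m + 1) * of_nat (Suc t) * (x / (fact (Suc m) * fact (Suc t) :: complex))" for x
  proof -
    have eq: "fact (Suc m) * fact (Suc t) = ((of_nat m + 1) * of_nat (Suc t)) * (fact m * fact t :: complex)"
      by (simp add: algebra_simps)
    have nz: "(of_nat m + 1) * of_nat (Suc t) \<noteq> (0 :: complex)"
      using of_nat_plus_1_nonzero[of m] of_nat_neq_0[of t, where ?'a = complex] by (simp del: of_nat_Suc)
    show ?thesis unfolding eq using nz by (rule expand_fraction)
  qed
  then show ?thesis using True by (simp only: lift_coeff_def t if_True)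
next
  case False
  define t where "t = nat (- 2 * n - int (Suc m))"
  have t: "nat (- 2 * n - int m) = Suc t" "nat (- 2 * n - int (Suc m)) = t"
    "of_nat m + of_int (2 * n) = - (of_nat (Suc t) :: complex)"
  proof -
    have "int m + 2 * n = - int (Suc t)" using assms False by (simp add: t_def)
    then have "of_int (int m + 2 * n) = (of_int (- int (Suc t)) :: complex)" by (rule arg_cong)
    then show "of_nat m + of_int (2 * n) = - (of_nat (Suc t) :: complex)"
      by (simp only: of_int_of_nat_eq of_int_add of_int_minus)
  qed (use assms False in \<open>auto simp: t_def\<close>)
  have "(-1) ^ m * fact (Suc t) / fact m =
      (of_nat m + 1) * - of_nat (Suc t) * ((-1) ^ Suc m * fact t / (fact (Suc m) :: complex))"
  proof -
    have step: "x / fact m = (of_nat m + 1) * (x / (fact (Suc m) :: complex))" for x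
      using expand_fraction[OF of_nat_plus_1_nonzero, of x "fact m" m] by (simp add: add.commute)
    have num: "(-1) ^ m * fact (Suc t) = - of_nat (Suc t) * ((-1) ^ Suc m * (fact t :: complex))"
      by (simp add: algebra_simps)
    show ?thesis unfolding step num by (simp only: mult.assoc times_divide_eq_right)
  qed
  moreover have "int m \<le> - 2 * n" "int (Suc m) \<le> - 2 * n" using False assms by auto
  ultimately show ?thesis using False by (simp only: lift_coeff_def t if_True if_False)
qed

lemma lift_term_has_field_derivative:
  assumes "f holomorphic_on upper_half_plane" "\<tau> \<in> upper_half_plane" "n > 0 \<or> int m < - 2 * n"
  shows "(lift_term n f m has_field_derivative
           (of_nat m + 1) * (of_nat m + of_int (2 * n)) * lift_term n f (Suc m) \<tau>) (at \<tau>)"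
proof -
  have "((\<lambda>\<tau>. lift_coeff n m * (deriv ^^ m) f \<tau>) has_field_derivative lift_coeff n m * (deriv ^^ Suc m) f \<tau>) (at \<tau>)"
    by (intro DERIV_cmult higher_deriv_has_field_derivative assms)
  moreover have "lift_term n f m = (\<lambda>\<tau>. lift_coeff n m * (deriv ^^ m) f \<tau>)"
    "lift_term n f (Suc m) \<tau> = lift_coeff n (Suc m) * (deriv ^^ Suc m) f \<tau>"
    using assms(3) by (subst lift_term_derivative_range; auto)+
  ultimately show ?thesis
    using lift_coeff_step[OF assms(3)] by (simp only: mult.assoc)
qed

lemma lift_term_moebius_derivative_range:
  assumes A: "A \<in> carrier SL2Z"
    and f: "f holomorphic_on upper_half_plane" and g: "g holomorphic_on upper_half_plane"
    and fg: "\<And>\<tau>. \<tau> \<in> upper_half_plane \<Longrightarrow> f (moebius A \<tau>) = automorphy_factor A \<tau> powi (2 * n) * g \<tau>"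
    and "n > 0 \<or> int m \<le> - 2 * n" "\<tau> \<in> upper_half_plane"
  shows "lift_term n f m (moebius A \<tau>) =
    automorphy_factor A \<tau> powi (2 * n + 2 * int m) * exp_twist (cocycle A \<tau>) (\<lambda>i. lift_term n g i \<tau>) m"
  using assms(5,6)
proof (induction m arbitrary: \<tau>)
  case 0
  then show ?case using fg[OF 0(2)]
    by (simp add: lift_term_derivative_range mult_ac)
next
  case (Suc m)
  have less: "n > 0 \<or> int i < - 2 * n" if "i \<le> m" for i using Suc.prems(1) that by auto
  show ?case
  proof (rule exp_twist_transformation_step[where \<phi> = "lift_term n f" and \<psi> = "lift_term n g" and k = "2 * n", OF A])
    show "int m + 2 * n \<noteq> 0" using less[of m] by auto
    show "lift_term n f m (moebius A \<tau>) = automorphy_factor A \<tau> powi (2 * n + 2 * int m) *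
        exp_twist (cocycle A \<tau>) (\<lambda>i. lift_term n g i \<tau>) m" if "\<tau> \<in> upper_half_plane" for \<tau>
      by (rule Suc.IH[OF _ that]) (use less[of m] in auto)
  qed (use less lift_term_has_field_derivative[OF f] lift_term_has_field_derivative[OF g] Suc.prems(2) in auto)
qed

section \<open>The functional equation of the lift and the bracket\<close>

text \<open>
  The factorials in \<^const>\<open>eta\<close> split into those of the two normalisations and a binomial coefficient;
  the sign \<open>(-1)^j\<close> in the bilinear form compensates the one in \<^const>\<open>lift_coeff\<close>.
\<close>

lemma lift_term_eta_range:
  assumes n: "n \<le> 0" and M: "M = nat (- 2 * n)"
  shows "lift_term n f (Suc (M + p)) \<tau> = tail_form M (\<lambda>j. lift_term n f j \<tau>) (\<lambda>i. E2_lift i \<tau>) p"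
proof -
  have M_eq: "2 * nat (- n) = M" "int M = - 2 * n" using n M by auto
  have "lift_coeff n (Suc (M + p)) = 1" and "bracket_deriv n f (Suc (M + p)) \<tau> = eta n f p \<tau>"
    using n M_eq(2) by (simp_all add: lift_coeff_def bracket_deriv_def flip: M_eq(2)) 
  then have "lift_term n f (Suc (M + p)) \<tau> = eta n f p \<tau>"
    by (simp add: lift_term_def)
  also have "\<dots> = of_real pi * \<i> / (6 * fact p) *
        (\<Sum>j\<le>M. 1 / (fact j * fact (M - j + p + 1)) * (deriv ^^ j) f \<tau> * (deriv ^^ (M + p - j)) E2 \<tau>)"
    by (simp only: eta_def Let_def M_eq atLeast0AtMost)
  also have "\<dots> = tail_form M (\<lambda>j. lift_term n f j \<tau>) (\<lambda>i. E2_lift i \<tau>) p"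
    unfolding tail_form_def sum_distrib_left
  proof (rule sum.cong)
    fix j assume "j \<in> {..M}"
    then have j: "j \<le> M" by simp
    have E: "E2_lift (M + p + 1 - j) \<tau> =
        of_real pi * \<i> / 6 * (deriv ^^ (M + p - j)) E2 \<tau> / (fact (M - j + p) * fact (M - j + p + 1))"
    proof -
      have "M + p + 1 - j = Suc (M - j + p)" "M + p - j = M - j + p" using j by simp_all
      then show ?thesis by (simp add: E2_lift_def del: fact_Suc)
    qed
    have F: "lift_term n f j \<tau> = (-1) ^ j * (fact (M - j) / fact j * (deriv ^^ j) f \<tau>)"
    proof -
      have "nat (- 2 * n - int j) = M - j" using j M_eq(2) by (simp add: nat_diff_distrib')
      then show ?thesis
        using n j M_eq(2) by (simp add: lift_term_derivative_range lift_coeff_def)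
    qed
    have B: "of_nat ((M - j + p) choose p) = (fact (M - j + p) / (fact p * fact (M - j)) :: complex)"
      by (subst binomial_fact) simp_all
    have sgn: "(-1) ^ j * (-1) ^ j = (1 :: complex)"
      by (simp flip: power_mult_distrib)
    have signs: "(-1) ^ j * B * ((-1) ^ j * x * y) = B * (x * y)" for B x y :: complex
    proof -
      have "(-1) ^ j * B * ((-1) ^ j * x * y) = ((-1) ^ j * (-1) ^ j) * (B * (x * y))"
        by (simp only: mult_ac)
      then show ?thesis by (simp only: sgn mult_1)
    qed
    show "of_real pi * \<i> / (6 * fact p) *
          (1 / (fact j * fact (M - j + p + 1)) * (deriv ^^ j) f \<tau> * (deriv ^^ (M + p - j)) E2 \<tau>) =
        (-1) ^ j * of_nat ((M - j + p) choose p) * (lift_term n f j \<tau> * E2_lift (M + p + 1 - j) \<tau>)"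
      unfolding F signs B E by (simp add: mult_ac del: fact_Suc)
  qed simp
  finally show ?thesis .
qed

lemma lift_term_eq_tail_form:
  assumes n: "n \<le> 0" and M: "M = nat (- 2 * n)"
  shows "(\<lambda>i. if i \<le> M then lift_term n f i \<tau>
            else tail_form M (\<lambda>j. lift_term n f j \<tau>) (\<lambda>i. E2_lift i \<tau>) (i - Suc M)) = (\<lambda>i. lift_term n f i \<tau>)"
proof
  fix i
  show "(if i \<le> M then lift_term n f i \<tau>
     else tail_form M (\<lambda>j. lift_term n f j \<tau>) (\<lambda>i. E2_lift i \<tau>) (i - Suc M)) = lift_term n f i \<tau>"
  proof (cases "i \<le> M")
    case False
    then have "i = Suc (M + (i - Suc M))" by simp
    then show ?thesis using lift_term_eta_range[OF assms, of f "i - Suc M" \<tau>] False by simp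
  qed simp
qed

text \<open>
  The automorphy factors add up to the same exponent in every summand of the bilinear form, since its
  two indices have constant sum \<open>m\<close>.
\<close>

lemma lift_term_moebius:
  assumes A: "A \<in> carrier SL2Z"
    and f: "f holomorphic_on upper_half_plane" and g: "g holomorphic_on upper_half_plane"
    and fg: "\<And>\<tau>. \<tau> \<in> upper_half_plane \<Longrightarrow> f (moebius A \<tau>) = automorphy_factor A \<tau> powi (2 * n) * g \<tau>"
    and \<tau>: "\<tau> \<in> upper_half_plane"
  shows "lift_term n f m (moebius A \<tau>) =
    automorphy_factor A \<tau> powi (2 * n + 2 * int m) * exp_twist (cocycle A \<tau>) (\<lambda>i. lift_term n g i \<tau>) m"
proof (cases "n > 0 \<or> int m \<le> - 2 * n")
  case True
  then show ?thesis using lift_term_moebius_derivative_range[OF A f g fg _ \<tau>] by simp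
next
  case False
  define M where "M = nat (- 2 * n)"
  have n: "n \<le> 0" and M: "int M = - 2 * n" "even M"
    using False by (auto simp: M_def even_nat_iff)
  define p where "p = m - Suc M"
  have m: "m = Suc (M + p)" using False M by (simp add: p_def)
  let ?J = "automorphy_factor A \<tau>" and ?K = "cocycle A \<tau>"
  let ?u = "\<lambda>j. lift_term n g j \<tau>" and ?v = "\<lambda>i. E2_lift i \<tau>"
  note J = automorphy_factor_nonzero[OF A \<tau>]
  have "lift_term n f m (moebius A \<tau>) =
      tail_form M (\<lambda>j. lift_term n f j (moebius A \<tau>)) (\<lambda>i. E2_lift i (moebius A \<tau>)) p"
    unfolding m by (rule lift_term_eta_range[OF n M_def])
  also have "\<dots> = ?J powi (2 * n + 2 * int m) * tail_form M (exp_twist ?K ?u) (exp_twist ?K ?v) p"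
    unfolding tail_form_def sum_distrib_left
  proof (rule sum.cong)
    fix j assume "j \<in> {..M}"
    then have j: "j \<le> M" by simp
    have f_j: "lift_term n f j (moebius A \<tau>) = ?J powi (2 * n + 2 * int j) * exp_twist ?K ?u j"
      by (rule lift_term_moebius_derivative_range[OF A f g fg _ \<tau>]) (use j M in auto)
    have E_j: "E2_lift (M + p + 1 - j) (moebius A \<tau>) = ?J powi (2 * int (M + p + 1 - j)) * exp_twist ?K ?v (M + p + 1 - j)"
      by (rule E2_lift_moebius[OF A \<tau>])
    have "?J powi (2 * n + 2 * int m) = ?J powi ((2 * n + 2 * int j) + 2 * int (M + p + 1 - j))"
      using j by (simp add: m of_nat_diff algebra_simps)
    also have "\<dots> = ?J powi (2 * n + 2 * int j) * ?J powi (2 * int (M + p + 1 - j))"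
      using J by (simp add: power_int_add)
    finally show "(-1) ^ j * of_nat ((M - j + p) choose p) *
        (lift_term n f j (moebius A \<tau>) * E2_lift (M + p + 1 - j) (moebius A \<tau>)) =
      ?J powi (2 * n + 2 * int m) * ((-1) ^ j * of_nat ((M - j + p) choose p) *
        (exp_twist ?K ?u j * exp_twist ?K ?v (M + p + 1 - j)))"
      unfolding f_j E_j by (simp only: mult_ac)
  qed simp
  also have "tail_form M (exp_twist ?K ?u) (exp_twist ?K ?v) p = exp_twist ?K ?u m"
  proof -
    have "?v 0 = 1" by (simp add: E2_lift_def)
    from tail_form_exp_twist[where M = M and v = ?v and u = ?u and K = ?K and p = p, OF M(2) this]
    show ?thesis unfolding m lift_term_eq_tail_form[OF n M_def] .
  qed
  finally show ?thesis .
qed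

lemma lift_series_moebius:
  assumes "A \<in> carrier SL2Z"
    and "f holomorphic_on upper_half_plane" "g holomorphic_on upper_half_plane"
    and "\<And>\<tau>. \<tau> \<in> upper_half_plane \<Longrightarrow> f (moebius A \<tau>) = automorphy_factor A \<tau> powi (2 * n) * g \<tau>"
    and "\<tau> \<in> upper_half_plane"
  shows "fps_nth (lift_series n f (moebius A \<tau>)) m =
    automorphy_factor A \<tau> powi (2 * n + 2 * int m) * fps_nth (fps_exp (cocycle A \<tau>) * lift_series n g \<tau>) m"
  using lift_term_moebius[OF assms, of m]
  by (simp add: exp_twist_eq_fps_nth lift_series_def lift_term_def)

text \<open>
  Here \<open>f' = f|A\<close> and \<open>h' = h|A\<close>. Replacing \<open>X\<close> by \<open>-X\<close> in one factor inverts its exponential,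
  so that the two exponentials cancel.
\<close>

lemma rankin_cohen_bracket_moebius:
  assumes A: "A \<in> carrier SL2Z"
    and f: "f holomorphic_on upper_half_plane" "f' holomorphic_on upper_half_plane"
      "\<And>\<tau>. \<tau> \<in> upper_half_plane \<Longrightarrow> f (moebius A \<tau>) = automorphy_factor A \<tau> powi (2 * n) * f' \<tau>"
    and h: "h holomorphic_on upper_half_plane" "h' holomorphic_on upper_half_plane"
      "\<And>\<tau>. \<tau> \<in> upper_half_plane \<Longrightarrow> h (moebius A \<tau>) = automorphy_factor A \<tau> powi (2 * k) * h' \<tau>"
    and \<tau>: "\<tau> \<in> upper_half_plane"
  shows "rankin_cohen_bracket n k s f h (moebius A \<tau>) =
    automorphy_factor A \<tau> powi (2 * n + 2 * k + 2 * int s) * rankin_cohen_bracket n k s f' h' \<tau>"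
proof -
  let ?J = "automorphy_factor A \<tau>" and ?K = "cocycle A \<tau>"
  let ?F = "lift_series n f' \<tau>" and ?H = "lift_series k h' \<tau>"
  note J = automorphy_factor_nonzero[OF A \<tau>]
  have "rankin_cohen_bracket n k s f h (moebius A \<tau>) =
      (\<Sum>m=0..s. (-1) ^ m * fps_nth (lift_series n f (moebius A \<tau>)) m * fps_nth (lift_series k h (moebius A \<tau>)) (s - m))"
    by (simp add: rankin_cohen_bracket_eq_coeff fps_compose_uminus' fps_mult_nth)
  also have "\<dots> = (\<Sum>m=0..s. ?J powi (2 * n + 2 * k + 2 * int s) *
      ((-1) ^ m * fps_nth (fps_exp ?K * ?F) m * fps_nth (fps_exp ?K * ?H) (s - m)))"
  proof (rule sum.cong)
    fix m assume m: "m \<in> {0..s}"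
    have "?J powi (2 * n + 2 * k + 2 * int s) = ?J powi ((2 * n + 2 * int m) + (2 * k + 2 * int (s - m)))"
      using m by (simp add: of_nat_diff algebra_simps)
    also have "\<dots> = ?J powi (2 * n + 2 * int m) * ?J powi (2 * k + 2 * int (s - m))"
      using J by (intro power_int_add) simp
    finally have J_split: "?J powi (2 * n + 2 * k + 2 * int s) = ?J powi (2 * n + 2 * int m) * ?J powi (2 * k + 2 * int (s - m))" .
    have f_m: "fps_nth (lift_series n f (moebius A \<tau>)) m = ?J powi (2 * n + 2 * int m) * fps_nth (fps_exp ?K * ?F) m"
      by (rule lift_series_moebius[OF A f \<tau>])
    have h_m: "fps_nth (lift_series k h (moebius A \<tau>)) (s - m) = ?J powi (2 * k + 2 * int (s - m)) * fps_nth (fps_exp ?K * ?H) (s - m)"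
      by (rule lift_series_moebius[OF A h \<tau>])
    show "(-1) ^ m * fps_nth (lift_series n f (moebius A \<tau>)) m * fps_nth (lift_series k h (moebius A \<tau>)) (s - m) =
      ?J powi (2 * n + 2 * k + 2 * int s) * ((-1) ^ m * fps_nth (fps_exp ?K * ?F) m * fps_nth (fps_exp ?K * ?H) (s - m))"
      unfolding f_m h_m J_split by (simp only: mult_ac)
  qed simp
  also have "\<dots> = ?J powi (2 * n + 2 * k + 2 * int s) *
      fps_nth (fps_compose (fps_exp ?K * ?F) (- fps_X) * (fps_exp ?K * ?H)) s"
    unfolding sum_distrib_left[symmetric] by (simp add: fps_compose_uminus' fps_mult_nth)
  also have "fps_compose (fps_exp ?K * ?F) (- fps_X) * (fps_exp ?K * ?H) = fps_compose ?F (- fps_X) * ?H"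
  proof -
    have inv: "fps_compose (fps_exp ?K) (- fps_X) = fps_exp (- ?K)"
      by (simp add: fps_compose_uminus' fps_eq_iff power_minus[of ?K])
    have one: "fps_exp (- ?K) * fps_exp ?K = 1"
      by (simp flip: fps_exp_add_mult)
    have "fps_compose (fps_exp ?K * ?F) (- fps_X) = fps_exp (- ?K) * fps_compose ?F (- fps_X)"
      unfolding inv[symmetric] by (rule fps_compose_mult_distrib) simp
    then have "fps_compose (fps_exp ?K * ?F) (- fps_X) * (fps_exp ?K * ?H) =
        (fps_exp (- ?K) * fps_exp ?K) * (fps_compose ?F (- fps_X) * ?H)"
      by (simp only: mult_ac)
    then show ?thesis unfolding one mult_1 .
  qed
  finally show ?thesis by (simp only: rankin_cohen_bracket_eq_coeff)
qed

lemma lift_term_holomorphic: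
  assumes "f holomorphic_on upper_half_plane"
  shows "lift_term n f m holomorphic_on upper_half_plane"
proof -
  have "eta n f p holomorphic_on upper_half_plane" for p
    unfolding eta_def[abs_def] Let_def
    by (intro holomorphic_intros holomorphic_higher_deriv[OF assms open_upper_half_plane]
        holomorphic_higher_deriv[OF E2_holomorphic open_upper_half_plane])
  moreover have "(deriv ^^ m) f holomorphic_on upper_half_plane"
    by (rule holomorphic_higher_deriv[OF assms open_upper_half_plane])
  ultimately show ?thesis
    unfolding lift_term_def[abs_def] bracket_deriv_def[abs_def] by (auto intro!: holomorphic_intros)
qed

lemma lift_term_meromorphic_at_infinity:
  assumes "f holomorphic_on upper_half_plane" "meromorphic_at_infinity f"
  shows "meromorphic_at_infinity (lift_term n f m)"
proof -
  have "meromorphic_at_infinity (eta n f p)" for p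
    unfolding eta_def[abs_def] Let_def
    by (intro meromorphic_at_infinity_mult meromorphic_at_infinity_sum meromorphic_at_infinity_const
        meromorphic_at_infinity_higher_deriv E2_meromorphic_at_infinity E2_holomorphic assms)
  moreover have "meromorphic_at_infinity ((deriv ^^ m) f)"
    by (intro meromorphic_at_infinity_higher_deriv assms)
  ultimately show ?thesis
    unfolding lift_term_def[abs_def] bracket_deriv_def[abs_def]
    by (auto intro!: meromorphic_at_infinity_mult meromorphic_at_infinity_const)
qed

lemma rankin_cohen_bracket_eq_sum:
  "rankin_cohen_bracket n k s f h = (\<lambda>\<tau>. \<Sum>m\<le>s. (-1) ^ m * (lift_term n f m \<tau> * lift_term k h (s - m) \<tau>))"
  by (simp add: fun_eq_iff rankin_cohen_bracket_eq_coeff fps_compose_uminus' fps_mult_nth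
      lift_series_def lift_term_def atLeast0AtMost mult.assoc)

lemma slash_holomorphic:
  assumes "A \<in> carrier SL2Z" "f holomorphic_on upper_half_plane"
  shows "slash j f A holomorphic_on upper_half_plane"
proof -
  have "moebius A holomorphic_on upper_half_plane"
    unfolding holomorphic_on_open[OF open_upper_half_plane]
    using moebius_has_field_derivative[OF assms(1)] by blast
  then have "(f \<circ> moebius A) holomorphic_on upper_half_plane"
    using moebius_in_upper_half_plane[OF assms(1)] assms(2)
    by (intro holomorphic_on_compose_gen[of _ _ _ upper_half_plane]) auto
  moreover have "(\<lambda>\<tau>. automorphy_factor A \<tau> powi (- j)) holomorphic_on upper_half_plane"
    unfolding holomorphic_on_open[OF open_upper_half_plane]
    using automorphy_factor_powi_has_field_derivative[OF assms(1)] by blast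
  ultimately show ?thesis
    unfolding slash_def[abs_def] comp_def by (rule holomorphic_on_mult[rotated])
qed

lemma powi_minus_cancel: "J \<noteq> 0 \<Longrightarrow> J powi (- j) * (J powi j * x) = x" for J x :: complex
  by (simp add: power_int_minus)

lemma moebius_eq_slash:
  assumes "A \<in> carrier SL2Z" "\<tau> \<in> upper_half_plane"
  shows "f (moebius A \<tau>) = automorphy_factor A \<tau> powi j * slash j f A \<tau>"
  using automorphy_factor_nonzero[OF assms] by (simp add: slash_def power_int_minus)

theorem mainTheorem4:
  fixes \<Gamma> :: "(int^2^2) set" and n k :: int and f h :: "complex \<Rightarrow> complex" and s :: nat
  assumes "congruence_subgroup \<Gamma>"
    and "f \<in> modular_forms (2 * n) \<Gamma>"
    and "h \<in> modular_forms (2 * k) \<Gamma>"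
  shows "rankin_cohen_bracket n k s f h \<in> modular_forms (2 * n + 2 * k + 2 * int s) \<Gamma>"
proof -
  let ?j = "2 * n + 2 * k + 2 * int s" and ?B = "rankin_cohen_bracket n k s"
  have \<Gamma>: "\<gamma> \<in> carrier SL2Z" if "\<gamma> \<in> \<Gamma>" for \<gamma>
    using assms(1) that by (auto simp: congruence_subgroup_def dest: subgroup.subset)
  have f: "f holomorphic_on upper_half_plane"
    "\<And>\<gamma> \<tau>. \<gamma> \<in> \<Gamma> \<Longrightarrow> \<tau> \<in> upper_half_plane \<Longrightarrow> f (moebius \<gamma> \<tau>) = automorphy_factor \<gamma> \<tau> powi (2 * n) * f \<tau>"
    "\<And>\<alpha>. \<alpha> \<in> carrier SL2Z \<Longrightarrow> meromorphic_at_infinity (slash (2 * n) f \<alpha>)"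
    using assms(2) by (auto simp: modular_forms_def)
  have h: "h holomorphic_on upper_half_plane"
    "\<And>\<gamma> \<tau>. \<gamma> \<in> \<Gamma> \<Longrightarrow> \<tau> \<in> upper_half_plane \<Longrightarrow> h (moebius \<gamma> \<tau>) = automorphy_factor \<gamma> \<tau> powi (2 * k) * h \<tau>"
    "\<And>\<alpha>. \<alpha> \<in> carrier SL2Z \<Longrightarrow> meromorphic_at_infinity (slash (2 * k) h \<alpha>)"
    using assms(3) by (auto simp: modular_forms_def)
  have "?B f h holomorphic_on upper_half_plane"
    unfolding rankin_cohen_bracket_eq_sum by (intro holomorphic_intros lift_term_holomorphic f h)
  moreover have "?B f h (moebius \<gamma> \<tau>) = automorphy_factor \<gamma> \<tau> powi ?j * ?B f h \<tau>"
    if "\<gamma> \<in> \<Gamma>" "\<tau> \<in> upper_half_plane" for \<gamma> \<tau>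
    by (rule rankin_cohen_bracket_moebius) (use that \<Gamma> f h in auto)
  moreover have "meromorphic_at_infinity (slash ?j (?B f h) \<alpha>)" if \<alpha>: "\<alpha> \<in> carrier SL2Z" for \<alpha>
  proof -
    let ?f = "slash (2 * n) f \<alpha>" and ?h = "slash (2 * k) h \<alpha>"
    note fh = slash_holomorphic[OF \<alpha> f(1), of "2 * n"] slash_holomorphic[OF \<alpha> h(1), of "2 * k"]
    have "slash ?j (?B f h) \<alpha> \<tau> = ?B ?f ?h \<tau>" if \<tau>: "\<tau> \<in> upper_half_plane" for \<tau>
    proof -
      have "?B f h (moebius \<alpha> \<tau>) = automorphy_factor \<alpha> \<tau> powi ?j * ?B ?f ?h \<tau>"
        by (rule rankin_cohen_bracket_moebius[OF \<alpha> f(1) fh(1) moebius_eq_slash[OF \<alpha>] h(1) fh(2) moebius_eq_slash[OF \<alpha>] \<tau>])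
      then show ?thesis
        by (simp only: slash_def powi_minus_cancel[OF automorphy_factor_nonzero[OF \<alpha> \<tau>]])
    qed
    moreover have "meromorphic_at_infinity (?B ?f ?h)"
      unfolding rankin_cohen_bracket_eq_sum
      by (intro meromorphic_at_infinity_sum meromorphic_at_infinity_mult meromorphic_at_infinity_const
          lift_term_meromorphic_at_infinity fh f(3) h(3) \<alpha>)
    ultimately show ?thesis
      using meromorphic_at_infinity_cong by blast
  qed
  ultimately show ?thesis by (simp add: modular_forms_def)
qed

end
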